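(* Let $X=(x_{ij})$ be an $n\times n$ matrix of indeterminates, and let $\alpha,\beta$ be finite multisets of the same cardinality with elements in $\{1,\dots,n\}$. The vector space $V(\alpha,\beta)$ is generated (spanned) by the monomials (bideterminants) corresponding to non-crossing bitableaux of content $(\alpha,\beta)$.
   Context: $P_{I,J}$ denotes the minor of $X$ with row set $I$ and column set $J$, $|I|=|J|$. A bideterminant is a product $M=P_{I^1,J^1}\cdots P_{I^h,J^h}$ of such minors; its content is $(\alpha,\beta)$, where $\alpha$ is the multiset union of the $I^i$ and $\beta$ the multiset union of the $J^i$. $V(\alpha,\beta)$ is the vector space (over $\mathbb{C}$) spanned by all bideterminants of content $(\alpha,\beta)$. A bitableau $(T,T')$ is a pair of fillings of the same Young diagram $\lambda$ with elements of $\{1,\dots,n\}$, with strictly increasing columns. Its monomial is $\prod_c P_{I_c,J_c}$, where $c$ runs over the columns of $\lambda$, $I_c$ is the set of entries of column $c$ of $T$, and $J_c$ is the set of entries of column $c$ of $T'$. Its content is $(\alpha,\beta)$, where $\alpha$ is the multiset of entries of $T$ and $\beta$ that of $T'$; the shape $\lambda$ may be any partition of $|\alpha|$. A bitableau $(T,T')$ is non-crossing if both $T$ and $T'$ are non-crossing in the following sense. Two disjoint finite sets of integers $a=\{a_1<\dots<a_p\}$ and $b=\{b_1<\dots<b_q\}$ with $p\ge q$ are non-crossing if: (1) for no $1\le i\le q-1$ does $a_i<b_i<a_{i+1}<b_{i+1}$ or $b_i<a_i<b_{i+1}<a_{i+1}$ hold; and (2) if $p>q$, then $a_q<b_q<a_{q+1}$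 does not hold. For a partition $\lambda$ of $N$, a (multiplicity-free) Non-Crossing Tableau of shape $\lambda$ is a set partition of $\{1,\dots,N\}$ into pairwise non-crossing blocks whose sizes are the column lengths of $\lambda$. Now let $T$ be a filling of shape $\lambda$ with strictly increasing columns in which the value $v$ occurs $\mu_v$ times, and let $B_1,B_2,\dots$ be the consecutive segments of $\{1,\dots,N\}$ of lengths $\mu_1,\mu_2,\dots$. The filling $T$ is non-crossing if: (i) there is a multiplicity-free Non-Crossing Tableau $\hat T$ of shape $\lambda$, each block of which contains at most one element of each segment $B_v$, such that replacing every element of $B_v$ by $v$ (for all $v$) turns the multiset of blocks of $\hat T$ into the multiset of columns of $T$; and (ii) the columns of equal length are arranged so that whenever a column $a$ is to the left of a different column $b$ of the same length, $a_s<b_s$ for the largest index $s$ with $a_s\ne b_s$. *)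

theory Defs
  imports
    "HOL-Library.Multiset"
    "HOL-Library.Disjoint_Sets"
    "HOL-Library.Poly_Mapping"
    "Jordan_Normal_Form.Determinant"
begin

text \<open>A monomial is a finitely supported family of exponents indexed by pairs (i,j), and a
  polynomial is a finitely supported family of coefficients indexed by monomials. The type
  provides an indeterminate for every pair of naturals; the ones belonging to the
  n by n matrix X are selected by requiring row and column indices to lie in {1..n}.\<close>

type_synonym matpoly = "((nat \<times> nat) \<Rightarrow>\<^sub>0 nat) \<Rightarrow>\<^sub>0 complex"

definition X :: "nat \<Rightarrow> nat \<Rightarrow> matpoly" where
  "X i j = Poly_Mapping.single (Poly_Mapping.single (i, j) 1) 1"

definition matpoly_scale :: "complex \<Rightarrow> matpoly \<Rightarrow> matpoly" where
  "matpoly_scale c p = Poly_Mapping.single 0 c * p"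

interpretation matpoly: vector_space matpoly_scale
  by unfold_locales
    (simp_all add: matpoly_scale_def distrib_left distrib_right single_add mult_single
      flip: mult.assoc)

definition minor :: "nat set \<Rightarrow> nat set \<Rightarrow> matpoly" where
  "minor I J = det (mat (card I) (card J)
     (\<lambda>(a, b). X (sorted_list_of_set I ! a) (sorted_list_of_set J ! b)))"

text \<open>A bideterminant is given by the list of its factors' index sets. The empty product is
  allowed; it has empty content.\<close>

definition minor_indices :: "nat \<Rightarrow> (nat set \<times> nat set) list \<Rightarrow> bool" where
  "minor_indices n Ms \<longleftrightarrow>
     (\<forall>(I, J) \<in> set Ms. I \<subseteq> {1..n} \<and> J \<subseteq> {1..n} \<and> card I = card J)"

definition bideterminant :: "(nat set \<times> nat set) list \<Rightarrow> matpoly" where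
  "bideterminant Ms = (\<Prod>(I, J)\<leftarrow>Ms. minor I J)"

definition bidet_content :: "(nat set \<times> nat set) list \<Rightarrow> nat multiset \<times> nat multiset" where
  "bidet_content Ms = ((\<Sum>(I, J)\<leftarrow>Ms. mset_set I), (\<Sum>(I, J)\<leftarrow>Ms. mset_set J))"

definition V :: "nat \<Rightarrow> nat multiset \<Rightarrow> nat multiset \<Rightarrow> matpoly set" where
  "V n \<alpha> \<beta> =
     matpoly.span {bideterminant Ms | Ms. minor_indices n Ms \<and> bidet_content Ms = (\<alpha>, \<beta>)}"

text \<open>A partition is the list of row lengths of its Young diagram.\<close>

definition is_partition :: "nat list \<Rightarrow> bool" where
  "is_partition lam \<longleftrightarrow> sorted_wrt (\<ge>) lam \<and> (\<forall>r \<in> set lam. 0 < r)"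

definition column_lengths :: "nat list \<Rightarrow> nat list" where
  "column_lengths lam =
     map (\<lambda>c. length (filter (\<lambda>r. c < r) lam)) [0..<(case lam of [] \<Rightarrow> 0 | r # _ \<Rightarrow> r)]"

text \<open>A filling is the list of its columns, from left to right, each read from top to bottom.\<close>

definition column_strict_filling :: "nat list \<Rightarrow> nat list list \<Rightarrow> bool" where
  "column_strict_filling lam T \<longleftrightarrow>
     map length T = column_lengths lam \<and> (\<forall>c \<in> set T. sorted_wrt (<) c)"

definition filling_content :: "nat list list \<Rightarrow> nat multiset" where
  "filling_content T = (\<Sum>c\<leftarrow>T. mset c)"

definition bitableau :: "nat \<Rightarrow> nat list \<Rightarrow> nat list list \<times> nat list list \<Rightarrow> bool" where
  "bitableau n lam = (\<lambda>(T, T').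
     is_partition lam \<and>
     column_strict_filling lam T \<and> column_strict_filling lam T' \<and>
     (\<forall>c \<in> set T. set c \<subseteq> {1..n}) \<and> (\<forall>c \<in> set T'. set c \<subseteq> {1..n}))"

definition bitableau_content ::
    "nat list list \<times> nat list list \<Rightarrow> nat multiset \<times> nat multiset" where
  "bitableau_content = (\<lambda>(T, T'). (filling_content T, filling_content T'))"

definition bitableau_monomial :: "nat list list \<times> nat list list \<Rightarrow> matpoly" where
  "bitableau_monomial = (\<lambda>(T, T'). \<Prod>(c, c')\<leftarrow>zip T T'. minor (set c) (set c'))"

text \<open>Only meant for disjoint nonempty finite sets with card b \<open>\<le>\<close> card a. List indexing starts at 0, so
  the i-th smallest element of a is at position i - 1.\<close>

definition noncrossing_sets :: "nat set \<Rightarrow> nat set \<Rightarrow> bool" where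
  "noncrossing_sets a b \<longleftrightarrow>
     (let p = card a; q = card b;
          a' = (\<lambda>i. sorted_list_of_set a ! (i - 1));
          b' = (\<lambda>i. sorted_list_of_set b ! (i - 1))
      in (\<forall>i. 1 \<le> i \<and> i \<le> q - 1 \<longrightarrow>
            \<not> (a' i < b' i \<and> b' i < a' (i + 1) \<and> a' (i + 1) < b' (i + 1)) \<and>
            \<not> (b' i < a' i \<and> a' i < b' (i + 1) \<and> b' (i + 1) < a' (i + 1))) \<and>
         (p > q \<longrightarrow> \<not> (a' q < b' q \<and> b' q < a' (q + 1))))"

definition multfree_noncrossing_tableau :: "nat list \<Rightarrow> nat set set \<Rightarrow> bool" where
  "multfree_noncrossing_tableau lam P \<longleftrightarrow>
     partition_on {1..sum_list lam} P \<and>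
     (\<forall>a \<in> P. \<forall>b \<in> P. a \<noteq> b \<and> card b \<le> card a \<longrightarrow> noncrossing_sets a b) \<and>
     image_mset card (mset_set P) = mset (column_lengths lam)"

text \<open>The segment of {1..N} belonging to the value v: the segments are consecutive and the one
  of v has length \<open>count \<mu> v\<close>.\<close>

definition segment :: "nat multiset \<Rightarrow> nat \<Rightarrow> nat set" where
  "segment \<mu> v = {(\<Sum>w<v. count \<mu> w) <.. (\<Sum>w\<le>v. count \<mu> w)}"

definition standardizes_to :: "nat list list \<Rightarrow> nat set set \<Rightarrow> bool" where
  "standardizes_to T P \<longleftrightarrow>
     (let B = segment (filling_content T)
      in (\<forall>S \<in> P. \<forall>v. card (S \<inter> B v) \<le> 1) \<and>
         image_mset (\<lambda>S. {v. S \<inter> B v \<noteq> {}}) (mset_set P) = image_mset set (mset T))"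

definition equal_columns_arranged :: "nat list list \<Rightarrow> bool" where
  "equal_columns_arranged T \<longleftrightarrow>
     (\<forall>k l. k < l \<and> l < length T \<and> length (T ! k) = length (T ! l) \<and> T ! k \<noteq> T ! l \<longrightarrow>
        (let s = Max {s. s < length (T ! k) \<and> T ! k ! s \<noteq> T ! l ! s}
         in T ! k ! s < T ! l ! s))"

definition noncrossing_filling :: "nat list \<Rightarrow> nat list list \<Rightarrow> bool" where
  "noncrossing_filling lam T \<longleftrightarrow>
     (\<exists>P. multfree_noncrossing_tableau lam P \<and> standardizes_to T P) \<and>
     equal_columns_arranged T"

definition noncrossing_bitableau ::
    "nat \<Rightarrow> nat list \<Rightarrow> nat list list \<times> nat list list \<Rightarrow> bool" where
  "noncrossing_bitableau n lam = (\<lambda>(T, T').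
     bitableau n lam (T, T') \<and> noncrossing_filling lam T \<and> noncrossing_filling lam T')"

end

theory Submission
  imports Defs
begin

text \<open>Leading terms replace straightening. By specialization of rows and columns it suffices to treat
  multilinear polynomials $f = \sum_\sigma f_\sigma \prod_i x_{i,\sigma(i)}$. Substitute $X = YZ$. By Cauchy--Binet
  the leading term of a bideterminant is
  $\prod_{i} y_{i,\kappa(i)} \prod_j z_{\kappa'(j),j}$, where $\kappa$ and $\kappa'$ record the position of
  every letter in its column; so it depends on the row contents of the two tableaux only. Conversely,
  $f(YZ)$ is invariant under $(Y, Z) \mapsto (Yg, g^{-1}Z)$, which forces the words $\kappa, \kappa'$ of its
  leading term to be lattice words: the relevant component is a highest weight vector, and on words in
  two letters the raising operator is injective where the larger letter prevails. Matching the letters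
  $k$ and $k+1$ of a lattice word like parentheses yields a non-crossing tableau with exactly these row
  contents. Hence every leading term is cancelled by that of a non-crossing bitableau, and subtracting it
  repeatedly reduces $f$ to zero.\<close>

subsection \<open>Digit sums and the colexicographic order\<close>

text \<open>The order on pairs of words has to serve two ends, and its first criterion, a small
  letter sum, fits both. For a product of minors the letters on each block must be distinct, so
  \<open>0, 1, 2, ...\<close> has the least sum, and among the words of that sum the increasing
  arrangement is colexicographically largest. For an arbitrary \<open>f\<close>, invariance trades
  raising a letter of one word for lowering a letter of the other; the pairs with a lowered letter
  precede the leading pair and vanish, which is the highest weight condition.

  A leading pair yields two sets of blocks, but does not say which block of one is paired with which
  block of the other. This freedom absorbs condition (ii), which orders the columns of each side on
  its own.

  Repeated indices come last: positions are replaced by indices once the blocks are known. Either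
  some block then repeats a row or column index and the product of minors is zero, or it is the
  monomial of a bitableau whose two fillings are standardized by the blocks themselves.\<close>

lemma digit_sum_less:
  fixes f :: "nat \<Rightarrow> nat"
  assumes "\<And>y. y < m \<Longrightarrow> f y < B"
  shows "(\<Sum>y<m. f y * B ^ y) < B ^ m"
  using assms
proof (induction m)
  case (Suc m)
  have "f m * B ^ m + B ^ m \<le> B * B ^ m"
    using Suc.prems[of m] by (metis Suc_leI add.commute lessI mult_Suc mult_le_mono1)
  moreover have "(\<Sum>y<m. f y * B ^ y) < B ^ m"
    using Suc by simp
  ultimately show ?case by simp
qed simp

lemma digit_sum_less_on:
  fixes f :: "nat \<Rightarrow> nat"
  assumes "A \<subseteq> {..<m}" "\<And>y. y \<in> A \<Longrightarrow> f y < B" "0 < B"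
  shows "(\<Sum>y\<in>A. f y * B ^ y) < B ^ m"
proof -
  have "(\<Sum>y\<in>A. f y * B ^ y) = (\<Sum>y<m. (if y \<in> A then f y else 0) * B ^ y)"
    using assms(1) by (intro sum.mono_neutral_cong_left) auto
  also have "\<dots> < B ^ m"
    using assms by (intro digit_sum_less) auto
  finally show ?thesis .
qed

text \<open>At \<open>x\<close>, the highest place of disagreement, \<open>g\<close> gains at least
  \<open>B ^ x\<close>, while the digits of \<open>f\<close> below \<open>x\<close> together amount
  to less than that.\<close>

lemma colex_digit_sum_less:
  fixes f g :: "nat \<Rightarrow> nat"
  assumes "finite A" "x \<in> A" "f x < g x"
    and eq: "\<And>y. y \<in> A \<Longrightarrow> x < y \<Longrightarrow> f y = g y"
    and "\<And>y. y \<in> A \<Longrightarrow> f y < B"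
  shows "(\<Sum>y\<in>A. f y * B ^ y) < (\<Sum>y\<in>A. g y * B ^ y)"
proof -
  define L where "L = {y \<in> A. y < x}"
  define U where "U = {y \<in> A. x < y}"
  have A: "A = L \<union> insert x U"
    using \<open>x \<in> A\<close> by (auto simp: L_def U_def)
  have split: "(\<Sum>y\<in>A. h y * B ^ y) = (\<Sum>y\<in>L. h y * B ^ y) + (h x * B ^ x + (\<Sum>y\<in>U. h y * B ^ y))"
    for h :: "nat \<Rightarrow> nat"
    using \<open>finite A\<close> by (subst A, subst sum.union_disjoint) (auto simp: L_def U_def)
  have "0 < B"
    using assms(5)[OF \<open>x \<in> A\<close>] by simp
  have "(\<Sum>y\<in>L. f y * B ^ y) < B ^ x"
    using assms(5) \<open>0 < B\<close> by (intro digit_sum_less_on) (auto simp: L_def)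
  moreover have "f x * B ^ x + B ^ x \<le> g x * B ^ x"
    using \<open>f x < g x\<close> by (metis Suc_leI add.commute mult_Suc mult_le_mono1)
  moreover have "(\<Sum>y\<in>U. f y * B ^ y) = (\<Sum>y\<in>U. g y * B ^ y)"
    using eq by (intro sum.cong) (auto simp: U_def)
  ultimately show ?thesis
    unfolding split by linarith
qed

lemma last_difference:
  fixes f g :: "'a::linorder \<Rightarrow> 'b"
  assumes "finite A" "\<exists>x\<in>A. f x \<noteq> g x"
  obtains x where "x \<in> A" "f x \<noteq> g x" "\<And>y. y \<in> A \<Longrightarrow> x < y \<Longrightarrow> f y = g y"
proof -
  let ?D = "{x \<in> A. f x \<noteq> g x}"
  have D: "finite ?D" "?D \<noteq> {}"
    using assms by auto
  show thesis
  proof (rule that[of "Max ?D"])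
    show "f y = g y" if "y \<in> A" "Max ?D < y" for y
    proof (rule ccontr)
      assume "f y \<noteq> g y"
      with that(1) have "y \<le> Max ?D"
        by (intro Max_ge[OF D(1)]) simp
      with that(2) show False by simp
    qed
  qed (use Max_in[OF D] in auto)
qed

text \<open>The maximum of \<open>c + 1\<close> naturals is at least \<open>c\<close>, and removing
  it leaves a smaller instance. Later \<open>K\<close> is the set of letters that a word takes on
  one block.\<close>

lemma sum_card_le_sum:
  fixes K :: "nat set"
  assumes "finite K"
  shows "\<Sum>{..<card K} \<le> \<Sum>K" and "\<Sum>K = \<Sum>{..<card K} \<Longrightarrow> K = {..<card K}"
proof -
  have "\<Sum>{..<card K} \<le> \<Sum>K \<and> (\<Sum>K = \<Sum>{..<card K} \<longrightarrow> K = {..<card K})"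
    using assms
  proof (induction "card K" arbitrary: K)
    case (Suc c)
    define M where "M = Max K"
    have M: "M \<in> K"
      using Suc.hyps Suc.prems by (metis M_def Max_in card.empty nat.distinct(1))
    have card: "card (K - {M}) = c"
      using Suc.hyps(2) M Suc.prems by simp
    have "K - {M} \<subseteq> {..<M}"
      using Max_ge[OF Suc.prems] by (fastforce simp: M_def less_le)
    then have "c \<le> M"
      using card by (metis card_lessThan card_mono finite_lessThan)
    have sum: "\<Sum>K = M + \<Sum>(K - {M})"
      using M Suc.prems by (simp add: sum.remove)
    have IH: "\<Sum>{..<c} \<le> \<Sum>(K - {M})" "\<Sum>(K - {M}) = \<Sum>{..<c} \<Longrightarrow> K - {M} = {..<c}"
      using Suc.hyps(1)[of "K - {M}"] card Suc.prems by auto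
    have s: "\<Sum>{..<card K} = c + \<Sum>{..<c}"
      by (simp flip: Suc.hyps(2) add: lessThan_Suc)
    have "K = {..<card K}" if "\<Sum>K = \<Sum>{..<card K}"
    proof -
      have "M = c" "\<Sum>(K - {M}) = \<Sum>{..<c}"
        using that s sum IH(1) \<open>c \<le> M\<close> by linarith+
      then have "K = insert c {..<c}"
        using IH(2) M by blast
      then show ?thesis
        by (simp flip: Suc.hyps(2) add: lessThan_Suc)
    qed
    then show ?case
      using s sum IH(1) \<open>c \<le> M\<close> by linarith
  qed simp
  then show "\<Sum>{..<card K} \<le> \<Sum>K" and "\<Sum>K = \<Sum>{..<card K} \<Longrightarrow> K = {..<card K}"
    by auto
qed

subsection \<open>Leading words of highest weight vectors\<close>

text \<open>The injectivity on words in two letters, a word being the set of places of its larger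
  letter. Double counting shows that \<open>g\<close> sums to zero over the \<open>b\<close>-sets
  containing a given \<open>J\<close> with fewer than \<open>b\<close> elements. Inclusion-exclusion
  extends this to the \<open>b\<close>-sets that also avoid a set \<open>U\<close>, as long as
  \<open>J\<close> and \<open>U\<close> together have fewer than \<open>b\<close> elements.\<close>

lemma inclusion_matrix_kernel:
  fixes g :: "'a set \<Rightarrow> 'b::field_char_0"
  assumes "finite Q" "card Q < 2 * b"
    and ker: "\<And>R. R \<subseteq> Q \<Longrightarrow> Suc (card R) = b \<Longrightarrow> (\<Sum>i\<in>Q - R. g (insert i R)) = 0"
    and "R\<^sub>0 \<subseteq> Q" "card R\<^sub>0 = b"
  shows "g R\<^sub>0 = 0"
proof -
  define S where "S J U = {R. J \<subseteq> R \<and> R \<subseteq> Q \<and> R \<inter> U = {} \<and> card R = b}" for J U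
  have fin: "finite (S J U)" for J U
    by (rule finite_subset[of _ "Pow Q"]) (use \<open>finite Q\<close> in \<open>auto simp: S_def\<close>)
  have finQ: "finite R" if "R \<subseteq> Q" for R
    using that \<open>finite Q\<close> finite_subset by blast
  have base: "sum g (S J {}) = 0" if J: "J \<subseteq> Q" "card J < b" for J
  proof -
    let ?P = "{R. J \<subseteq> R \<and> R \<subseteq> Q \<and> Suc (card R) = b}"
    have finP: "finite ?P"
      by (rule finite_subset[of _ "Pow Q"]) (use \<open>finite Q\<close> in auto)
    have "0 = (\<Sum>R\<in>?P. \<Sum>i\<in>Q - R. g (insert i R))"
      using ker by simp
    also have "\<dots> = (\<Sum>(R, i)\<in>Sigma ?P (\<lambda>R. Q - R). g (insert i R))"
      using finP \<open>finite Q\<close> by (subst sum.Sigma) auto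
    \<comment> \<open>Replacing \<open>R\<close> by \<open>insert i R\<close> counts each
      \<open>b\<close>-set containing \<open>J\<close> once for every element outside
      \<open>J\<close>. The resulting factor \<open>b - card J\<close> is invertible in
      characteristic 0.\<close>
    also have "\<dots> = (\<Sum>(R, i)\<in>Sigma (S J {}) (\<lambda>R. R - J). g R)"
      by (rule sum.reindex_bij_witness[where i = "\<lambda>(R, i). (R - {i}, i)" and j = "\<lambda>(R, i). (insert i R, i)"])
        (use J in \<open>auto simp: S_def finQ card_Diff_singleton insert_absorb\<close>)
    also have "\<dots> = (\<Sum>R\<in>S J {}. \<Sum>i\<in>R - J. g R)"
      using fin by (subst sum.Sigma) (auto simp: S_def finQ)
    also have "\<dots> = (\<Sum>R\<in>S J {}. of_nat (b - card J) * g R)"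
      using J by (intro sum.cong refl) (auto simp: S_def card_Diff_subset finQ)
    also have "\<dots> = of_nat (b - card J) * sum g (S J {})"
      by (simp add: sum_distrib_left)
    finally show ?thesis
      using J by simp
  qed
  have "sum g (S J U) = 0" if "finite U" "U \<subseteq> Q" "J \<subseteq> Q" "J \<inter> U = {}" "card J + card U < b" for J U
    using that
  proof (induction U arbitrary: J rule: finite_induct)
    case empty
    then show ?case by (simp add: base)
  next
    case (insert u U)
    have "S J U = S J (insert u U) \<union> S (insert u J) U"
      by (auto simp: S_def)
    moreover have "S J (insert u U) \<inter> S (insert u J) U = {}"
      by (auto simp: S_def)
    ultimately have "sum g (S J U) = sum g (S J (insert u U)) + sum g (S (insert u J) U)"
      using fin by (simp add: sum.union_disjoint)
    moreover have "sum g (S J U) = 0"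
      using insert.prems insert.hyps by (intro insert.IH) auto
    moreover have "sum g (S (insert u J) U) = 0"
      using insert.prems insert.hyps by (intro insert.IH) (auto simp: finQ)
    ultimately show ?case by simp
  qed
  \<comment> \<open>The complement of \<open>R\<^sub>0\<close> has \<open>card Q - b < b\<close>
    elements, and \<open>R\<^sub>0\<close> is the only \<open>b\<close>-subset of \<open>Q\<close>
    avoiding it.\<close>
  from this[of "Q - R\<^sub>0" "{}"] have "sum g (S {} (Q - R\<^sub>0)) = 0"
    using assms by (auto simp: card_Diff_subset finQ)
  moreover have "S {} (Q - R\<^sub>0) = {R\<^sub>0}"
  proof -
    have "R = R\<^sub>0" if "R \<in> S {} (Q - R\<^sub>0)" for R
      using that assms by (intro card_subset_eq) (auto simp: S_def finQ)
    then show ?thesis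
      using assms by (auto simp: S_def)
  qed
  ultimately show ?thesis by simp
qed

text \<open>Suppose \<open>Suc k\<close> outnumbers \<open>k\<close> in the prefix up to
  \<open>m\<close>. Redistributing these letters over their positions \<open>Q\<close> turns
  \<open>G\<close> into a function on subsets of \<open>Q\<close>. It satisfies the kernel condition
  of \<open>inclusion_matrix_kernel\<close> by \<open>raise\<close>, after \<open>lead\<close> has
  removed the terms that change a position beyond \<open>m\<close>; so it vanishes, even at
  \<kappa>.\<close>

lemma leading_word_lattice:
  fixes G :: "(nat \<Rightarrow> nat) \<Rightarrow> complex"
  assumes "finite A" and nz: "G \<kappa> \<noteq> 0" and bound: "\<And>x. x \<in> A \<Longrightarrow> \<kappa> x < N"
    and raise: "\<And>u. (\<Sum>x\<in>A. u x) < (\<Sum>x\<in>A. \<kappa> x) \<Longrightarrow> (\<And>x. x \<in> A \<Longrightarrow> u x < N) \<Longrightarrow>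
      (\<Sum>i | i \<in> A \<and> u i = k. G (u(i := Suc k))) = 0"
    and lead: "\<And>u x. x \<in> A \<Longrightarrow> \<kappa> x < u x \<Longrightarrow> (\<And>y. y \<in> A \<Longrightarrow> x < y \<Longrightarrow> u y = \<kappa> y) \<Longrightarrow>
      (\<Sum>x\<in>A. u x) = (\<Sum>x\<in>A. \<kappa> x) \<Longrightarrow> (\<And>y. y \<in> A \<Longrightarrow> u y < N) \<Longrightarrow> G u = 0"
  shows "card {x \<in> A. x \<le> m \<and> \<kappa> x = Suc k} \<le> card {x \<in> A. x \<le> m \<and> \<kappa> x = k}"
proof (rule ccontr)
  assume neg: "\<not> ?thesis"
  define R\<^sub>0 where "R\<^sub>0 = {x \<in> A. x \<le> m \<and> \<kappa> x = Suc k}"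
  define Z where "Z = {x \<in> A. x \<le> m \<and> \<kappa> x = k}"
  define Q where "Q = Z \<union> R\<^sub>0"
  \<comment> \<open>\<open>R\<close> collects the positions of \<open>Q\<close> that carry
    \<open>Suc k\<close>; the choice \<open>R\<^sub>0\<close> gives back \<kappa>.\<close>
  define w where "w R = (\<lambda>x. if x \<in> Q then if x \<in> R then Suc k else k else \<kappa> x)" for R
  have fin: "finite Z" "finite R\<^sub>0" "finite Q"
    using \<open>finite A\<close> by (auto simp: Z_def R\<^sub>0_def Q_def)
  have QA: "Q \<subseteq> A"
    by (auto simp: Q_def Z_def R\<^sub>0_def)
  have cardQ: "card Q = card Z + card R\<^sub>0"
    unfolding Q_def using fin by (intro card_Un_disjoint) (auto simp: Z_def R\<^sub>0_def)
  have "R\<^sub>0 \<noteq> {}"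
    using neg by (auto simp: R\<^sub>0_def[symmetric])
  then have kN: "Suc k < N"
    using bound by (force simp: R\<^sub>0_def)
  have wN: "w R x < N" if "x \<in> A" for R x
    using that kN bound by (auto simp: w_def)
  have wR0: "w R\<^sub>0 = \<kappa>"
    by (auto simp: w_def Q_def R\<^sub>0_def Z_def)
  have sumw: "(\<Sum>x\<in>A. w R x) = (\<Sum>x\<in>A - Q. \<kappa> x) + card Q * k + card R" if "R \<subseteq> Q" for R
  proof -
    have "(\<Sum>x\<in>A. w R x) = (\<Sum>x\<in>A - Q. w R x) + (\<Sum>x\<in>Q. w R x)"
      using QA \<open>finite A\<close> by (rule sum.subset_diff)
    also have "(\<Sum>x\<in>A - Q. w R x) = (\<Sum>x\<in>A - Q. \<kappa> x)"
      by (intro sum.cong) (auto simp: w_def)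
    also have "(\<Sum>x\<in>Q. w R x) = (\<Sum>x\<in>Q. k + (if x \<in> R then 1 else 0))"
      by (intro sum.cong) (auto simp: w_def)
    also have "\<dots> = card Q * k + card R"
      using that fin by (simp add: sum.distrib Int_absorb1 flip: sum.inter_restrict)
    finally show ?thesis by simp
  qed
  have R0Q: "R\<^sub>0 \<subseteq> Q"
    by (simp add: Q_def)
  have "G (w R\<^sub>0) = 0"
  proof (rule inclusion_matrix_kernel[where Q = Q and b = "card R\<^sub>0" and g = "\<lambda>R. G (w R)"])
    show "card Q < 2 * card R\<^sub>0"
      using neg cardQ by (simp add: R\<^sub>0_def Z_def)
    fix R assume R: "R \<subseteq> Q" "Suc (card R) = card R\<^sub>0"
    let ?I = "{i. i \<in> A \<and> w R i = k}"
    have sumR: "Suc (\<Sum>x\<in>A. w R x) = (\<Sum>x\<in>A. \<kappa> x)"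
      using sumw[OF R(1)] sumw[OF R0Q] R(2) wR0 by simp
    have "0 = (\<Sum>i\<in>?I. G ((w R)(i := Suc k)))"
      using sumR wN by (intro raise[symmetric]) auto
    also have "\<dots> = (\<Sum>i\<in>Q - R. G ((w R)(i := Suc k)))"
    proof (rule sum.mono_neutral_right)
      show "finite ?I" using \<open>finite A\<close> by simp
      show "Q - R \<subseteq> ?I"
        using QA by (auto simp: w_def)
      show "\<forall>i\<in>?I - (Q - R). G ((w R)(i := Suc k)) = 0"
      proof
        fix i assume i: "i \<in> ?I - (Q - R)"
        then have iA: "i \<in> A" and wi: "w R i = k" and iQ: "i \<notin> Q"
          by (auto simp: w_def split: if_splits)
        then have \<kappa>i: "\<kappa> i = k"
          by (simp add: w_def)
        \<comment> \<open>A letter \<open>k\<close> outside \<open>Q\<close> stands beyond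
          \<open>m\<close>. Raising it gives a word of the same sum as \<kappa> but
          colexicographically larger.\<close>
        have "m < i"
          using iA iQ \<kappa>i by (force simp: Q_def Z_def)
        show "G ((w R)(i := Suc k)) = 0"
        proof (rule lead[OF iA])
          fix y assume "y \<in> A" "i < y"
          then show "((w R)(i := Suc k)) y = \<kappa> y"
            using \<open>m < i\<close> by (auto simp: w_def Q_def Z_def R\<^sub>0_def)
        next
          have "(\<Sum>x\<in>A. ((w R)(i := Suc k)) x) = Suc (\<Sum>x\<in>A. w R x)"
            using iA \<open>finite A\<close> wi by (simp add: sum.remove[of A i])
          then show "(\<Sum>x\<in>A. ((w R)(i := Suc k)) x) = (\<Sum>x\<in>A. \<kappa> x)"
            using sumR by simp
        qed (use \<kappa>i kN wN in auto)
      qed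
    qed
    also have "\<dots> = (\<Sum>i\<in>Q - R. G (w (insert i R)))"
      by (intro sum.cong refl arg_cong[where f = G]) (auto simp: w_def)
    finally show "(\<Sum>i\<in>Q - R. G (w (insert i R))) = 0" by simp
  qed (use fin R0Q in auto)
  with nz wR0 show False by simp
qed

subsection \<open>Non-crossing matchings of lattice words\<close>

text \<open>The one-sided form of the non-crossing condition; a missing next element of \<open>b\<close> counts
  as infinite, which covers clause (2) of the definition.\<close>

definition arcs_ok :: "nat list \<Rightarrow> nat list \<Rightarrow> bool" where
  "arcs_ok a b \<longleftrightarrow> (\<forall>i. Suc i < length a \<longrightarrow> i < length b \<longrightarrow> a ! i < b ! i \<longrightarrow> b ! i < a ! Suc i \<longrightarrow>
     Suc i < length b \<and> b ! Suc i < a ! Suc i)"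

lemma sorted_list_of_set_strict: "sorted_wrt (<) (a :: nat list) \<Longrightarrow> sorted_list_of_set (set a) = a"
  by (simp add: strict_sorted_iff sorted_list_of_set.idem_if_sorted_distinct)

lemma card_set_strict: "sorted_wrt (<) (a :: nat list) \<Longrightarrow> card (set a) = length a"
  by (simp add: strict_sorted_iff distinct_card)

text \<open>\<open>arcs_ok a b\<close> and \<open>arcs_ok b a\<close> exclude one pattern of clause
  (1) each. In the situation of clause (2), \<open>arcs_ok a b\<close> would ask for a successor of
  the last element of \<open>b\<close>.\<close>

lemma noncrossing_sets_of_arcs_ok:
  assumes "sorted_wrt (<) a" "sorted_wrt (<) b" "arcs_ok a b" "arcs_ok b a" "length b \<le> length a"
  shows "noncrossing_sets (set a) (set b)"
proof -
  have "\<not> (a ! (i - 1) < b ! (i - 1) \<and> b ! (i - 1) < a ! (i + 1 - 1) \<and> a ! (i + 1 - 1) < b ! (i + 1 - 1))"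
    "\<not> (b ! (i - 1) < a ! (i - 1) \<and> a ! (i - 1) < b ! (i + 1 - 1) \<and> b ! (i + 1 - 1) < a ! (i + 1 - 1))"
    if i: "1 \<le> i" "i \<le> length b - 1" for i
  proof -
    obtain j where "i = Suc j"
      using i by (cases i) auto
    then show "\<not> (a ! (i - 1) < b ! (i - 1) \<and> b ! (i - 1) < a ! (i + 1 - 1) \<and> a ! (i + 1 - 1) < b ! (i + 1 - 1))"
      "\<not> (b ! (i - 1) < a ! (i - 1) \<and> a ! (i - 1) < b ! (i + 1 - 1) \<and> b ! (i + 1 - 1) < a ! (i + 1 - 1))"
      using assms(3-5) i by (auto simp: arcs_ok_def dest!: spec[of _ j])
  qed
  moreover have "\<not> (a ! (length b - 1) < b ! (length b - 1) \<and> b ! (length b - 1) < a ! (length b + 1 - 1))"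
    if "length a > length b"
  proof (cases "length b")
    case 0
    then show ?thesis by simp
  next
    case (Suc j)
    then show ?thesis
      using assms(3) that unfolding arcs_ok_def by (auto dest!: spec[of _ j])
  qed
  ultimately show ?thesis
    using assms(1,2) unfolding noncrossing_sets_def Let_def
    by (simp add: sorted_list_of_set_strict card_set_strict)
qed

text \<open>Letters are row numbers counted from 0, so the word prescribes the row of every
  position. The pairs of blocks are ordered, which imposes \<open>arcs_ok\<close> in both
  directions.\<close>

definition noncrossing_matching :: "nat \<Rightarrow> (nat \<Rightarrow> nat) \<Rightarrow> nat list set \<Rightarrow> bool" where
  "noncrossing_matching N \<kappa> Q \<longleftrightarrow>
     finite Q \<and>
     (\<forall>b\<in>Q. b \<noteq> [] \<and> sorted_wrt (<) b \<and> (\<forall>i<length b. \<kappa> (b ! i) = i)) \<and>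
     (\<forall>b\<in>Q. \<forall>c\<in>Q. b \<noteq> c \<longrightarrow> set b \<inter> set c = {} \<and> arcs_ok b c) \<and>
     (\<Union>b\<in>Q. set b) = {1..N}"

lemma noncrossing_matchingD:
  assumes "noncrossing_matching N \<kappa> Q"
  shows "finite Q" "b \<in> Q \<Longrightarrow> b \<noteq> []" "b \<in> Q \<Longrightarrow> sorted_wrt (<) b"
    "b \<in> Q \<Longrightarrow> i < length b \<Longrightarrow> \<kappa> (b ! i) = i"
    "b \<in> Q \<Longrightarrow> c \<in> Q \<Longrightarrow> b \<noteq> c \<Longrightarrow> set b \<inter> set c = {}"
    "b \<in> Q \<Longrightarrow> c \<in> Q \<Longrightarrow> b \<noteq> c \<Longrightarrow> arcs_ok b c"
    "(\<Union>b\<in>Q. set b) = {1..N}"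
  using assms unfolding noncrossing_matching_def by blast+

text \<open>Sending a block to its entry at index \<open>j\<close> is a bijection. Hence the word
  alone fixes the block lengths, and with them the shape.\<close>

lemma noncrossing_matching_letter_count:
  assumes "noncrossing_matching N \<kappa> Q"
  shows "card {x \<in> {1..N}. \<kappa> x = j} = card {b \<in> Q. j < length b}"
proof -
  note D = noncrossing_matchingD[OF assms]
  have "bij_betw (\<lambda>b. b ! j) {b \<in> Q. j < length b} {x \<in> {1..N}. \<kappa> x = j}"
  proof (rule bij_betw_imageI)
    show "inj_on (\<lambda>b. b ! j) {b \<in> Q. j < length b}"
      using D(5) by (intro inj_onI) (metis (mono_tags, lifting) disjoint_iff mem_Collect_eq nth_mem)
    show "(\<lambda>b. b ! j) ` {b \<in> Q. j < length b} = {x \<in> {1..N}. \<kappa> x = j}"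
    proof (intro equalityI subsetI)
      fix x assume "x \<in> (\<lambda>b. b ! j) ` {b \<in> Q. j < length b}"
      then obtain b where b: "b \<in> Q" "j < length b" "x = b ! j"
        by auto
      then have "x \<in> {1..N}"
        using D(7) nth_mem[of j b] by blast
      then show "x \<in> {x \<in> {1..N}. \<kappa> x = j}"
        using b D(4) by auto
    next
      fix x assume x: "x \<in> {x \<in> {1..N}. \<kappa> x = j}"
      then have "x \<in> (\<Union>b\<in>Q. set b)"
        using D(7) by simp
      then obtain b i where "b \<in> Q" "i < length b" "x = b ! i"
        by (auto simp: in_set_conv_nth)
      then show "x \<in> (\<lambda>b. b ! j) ` {b \<in> Q. j < length b}"
        using x D(4) by force
    qed
  qed
  then show ?thesis
    by (simp add: bij_betw_same_card)
qed

text \<open>The only new arc runs from \<open>last a\<close> to \<open>z\<close>. If the entry of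
  \<open>b\<close> in the row of \<open>last a\<close> lies under it, its successor in
  \<open>b\<close> is below \<open>z\<close> anyway. The successor is missing only if
  \<open>b\<close> is as long as \<open>a\<close>, and then \<open>last b \<le> last a\<close> keeps
  that entry from lying under the arc.\<close>

lemma arcs_ok_snoc_left:
  assumes "arcs_ok a b" "sorted_wrt (<) b"
    and "length b = length a \<Longrightarrow> last b \<le> last a" "\<And>y. y \<in> set b \<Longrightarrow> y < z"
  shows "arcs_ok (a @ [z]) b"
  unfolding arcs_ok_def
proof (intro allI impI)
  fix i assume i: "Suc i < length (a @ [z])" "i < length b" "(a @ [z]) ! i < b ! i" "b ! i < (a @ [z]) ! Suc i"
  show "Suc i < length b \<and> b ! Suc i < (a @ [z]) ! Suc i"
  proof (cases "Suc i < length a")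
    case True
    then show ?thesis
      using i assms(1) unfolding arcs_ok_def by (auto simp: nth_append)
  next
    case False
    then have len: "length a = Suc i"
      using i(1) by simp
    then have lt: "last a < b ! i"
      using i(3) by (metis diff_Suc_1 last_conv_nth length_0_conv lessI nat.simps(3) nth_append)
    have "length b \<noteq> Suc i"
    proof
      assume "length b = Suc i"
      then have "last b = b ! i"
        by (metis diff_Suc_1 last_conv_nth length_0_conv nat.simps(3))
      then show False
        using assms(3) lt len \<open>length b = Suc i\<close> by simp
    qed
    then have "Suc i < length b"
      using i(2) by simp
    then show ?thesis
      using assms(4) len by (simp add: nth_append)
  qed
qed

lemma arcs_ok_snoc_right:
  assumes "arcs_ok b a" "\<And>y. y \<in> set b \<Longrightarrow> y < z"
  shows "arcs_ok b (a @ [z])"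
  unfolding arcs_ok_def
proof (intro allI impI)
  fix i assume i: "Suc i < length b" "i < length (a @ [z])" "b ! i < (a @ [z]) ! i" "(a @ [z]) ! i < b ! Suc i"
  have "i < length a"
  proof (rule ccontr)
    assume "\<not> i < length a"
    then have "i = length a"
      using i(2) by simp
    then show False
      using i(1,4) assms(2)[of "b ! Suc i"] by simp
  qed
  then have "Suc i < length a \<and> a ! Suc i < b ! Suc i"
    using i assms(1) unfolding arcs_ok_def by (simp add: nth_append)
  then show "Suc i < length (a @ [z]) \<and> (a @ [z]) ! Suc i < b ! Suc i"
    by (simp add: nth_append)
qed

text \<open>Reading the word from left to right, a letter \<open>k\<close> extends the block of size \<open>k\<close> whose
  last element is the most recent one, as in the matching of parentheses.\<close>

lemma noncrossing_matching_exists: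
  assumes "\<And>m k. m \<le> N \<Longrightarrow> card {x \<in> {1..m}. \<kappa> x = Suc k} \<le> card {x \<in> {1..m}. \<kappa> x = k}"
  shows "\<exists>Q. noncrossing_matching N \<kappa> Q"
  using assms
proof (induction N)
  case 0
  have "noncrossing_matching 0 \<kappa> {}"
    by (simp add: noncrossing_matching_def)
  then show ?case ..
next
  case (Suc N)
  then obtain Q where Q: "noncrossing_matching N \<kappa> Q"
    by (meson le_SucI)
  note D = noncrossing_matchingD[OF Q]
  define z where "z = Suc N"
  have less: "y < z" if "b \<in> Q" "y \<in> set b" for b y
  proof -
    have "y \<in> {1..N}"
      using that D(7) by blast
    then show ?thesis
      by (simp add: z_def)
  qed
  have z_notin: "z \<notin> set b" if "b \<in> Q" for b
    using less[OF that] by blast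
  have Un: "insert z {1..N} = {1..Suc N}"
    by (auto simp: z_def)
  show ?case
  proof (cases "\<kappa> z")
    case 0
    have "arcs_ok b [z]" if "b \<in> Q" for b
      using less[OF that] unfolding arcs_ok_def by (metis One_nat_def length_Cons less_Suc0 list.size(3)
          nth_Cons_0 nth_mem order_less_asym)
    moreover have "arcs_ok [z] b" for b
      by (simp add: arcs_ok_def)
    ultimately have "noncrossing_matching (Suc N) \<kappa> (insert [z] Q)"
      using Q 0 z_notin Un unfolding noncrossing_matching_def by auto
    then show ?thesis ..
  next
    case (Suc j)
    let ?C = "{b \<in> Q. length b = Suc j}"
    have "{x \<in> {1..Suc N}. \<kappa> x = Suc j} = insert z {x \<in> {1..N}. \<kappa> x = Suc j}"
      using Suc by (auto simp: z_def le_Suc_eq)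
    moreover have "{x \<in> {1..Suc N}. \<kappa> x = j} = {x \<in> {1..N}. \<kappa> x = j}"
      using Suc by (auto simp: z_def le_Suc_eq)
    moreover have "z \<notin> {x \<in> {1..N}. \<kappa> x = Suc j}"
      by (simp add: z_def)
    \<comment> \<open>The lattice condition for the prefix ending in \<open>z\<close>, which
      contains one more letter \<open>Suc j\<close>. It makes the blocks longer than
      \<open>j\<close> strictly more numerous than those longer than \<open>Suc j\<close>, so some
      block has length exactly \<open>Suc j\<close>.\<close>
    ultimately have "Suc (card {x \<in> {1..N}. \<kappa> x = Suc j}) \<le> card {x \<in> {1..N}. \<kappa> x = j}"
      using Suc.prems[of "Suc N" j] by simp
    then have lt: "card {b \<in> Q. Suc j < length b} < card {b \<in> Q. j < length b}"
      using noncrossing_matching_letter_count[OF Q, of j] noncrossing_matching_letter_count[OF Q, of "Suc j"]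
      by simp
    have "?C \<noteq> {}"
    proof
      assume "?C = {}"
      then have "{b \<in> Q. Suc j < length b} = {b \<in> Q. j < length b}"
        by (auto simp: Suc_lessI)
      with lt show False by simp
    qed
    moreover have "finite ?C"
      using D(1) by simp
    \<comment> \<open>Maximality of the last element is what \<open>arcs_ok_snoc_left\<close> asks
      about the other blocks of the same length.\<close>
    ultimately obtain S where S: "S \<in> ?C" "last S = Max (last ` ?C)"
      using Max_in[of "last ` ?C"] by (metis (no_types, lifting) finite_imageI image_iff image_is_empty)
    then have last: "last b \<le> last S" if "b \<in> ?C" for b
      using that \<open>finite ?C\<close> by simp
    define S' where "S' = S @ [z]"
    have SQ: "S \<in> Q" and lenS: "length S = Suc j"
      using S by auto
    have sorted: "sorted_wrt (<) S'"
      using D(3)[OF SQ] less[OF SQ] by (auto simp: S'_def sorted_wrt_append)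
    have rank: "\<kappa> (S' ! i) = i" if "i < length S'" for i
      using that D(4)[OF SQ] lenS Suc by (cases "i = Suc j") (auto simp: S'_def nth_append)
    have arcs: "arcs_ok S' b" "arcs_ok b S'" if b: "b \<in> Q" "b \<noteq> S" for b
    proof -
      show "arcs_ok S' b" unfolding S'_def
        using b SQ lenS by (intro arcs_ok_snoc_left D(3,6) less[of b] last) auto
      show "arcs_ok b S'" unfolding S'_def
        using b SQ by (intro arcs_ok_snoc_right D(6) less[of b]) auto
    qed
    have disj: "set S' \<inter> set b = {}" "set b \<inter> set S' = {}" if b: "b \<in> Q" "b \<noteq> S" for b
      using D(5)[OF SQ b(1)] b z_notin[OF b(1)] by (auto simp: S'_def)
    have "(\<Union>b\<in>insert S' (Q - {S}). set b) = insert z (\<Union>b\<in>Q. set b)"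
      using SQ by (auto simp: S'_def)
    then have "noncrossing_matching (Suc N) \<kappa> (insert S' (Q - {S}))"
      unfolding noncrossing_matching_def using D sorted rank arcs disj Un
      by (auto simp: S'_def[symmetric]) (auto simp: S'_def)
    then show ?thesis ..
  qed
qed

subsection \<open>The shape of a matching\<close>

text \<open>The multiplicity of a positive number is the difference of two consecutive
  tails.\<close>

lemma multiset_eq_of_tails:
  fixes M M' :: "nat multiset"
  assumes "0 \<notin># M" "0 \<notin># M'"
    and "\<And>j. size (filter_mset (\<lambda>x. j < x) M) = size (filter_mset (\<lambda>x. j < x) M')"
  shows "M = M'"
proof (rule multiset_eqI)
  fix x
  have tail: "size (filter_mset (\<lambda>x. j < x) L) = size (filter_mset (\<lambda>x. Suc j < x) L) + count L (Suc j)"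
    for j and L :: "nat multiset"
    by (induction L) auto
  show "count M x = count M' x"
  proof (cases x)
    case 0
    then show ?thesis
      using assms(1,2) by (simp add: not_in_iff)
  next
    case (Suc j)
    then show ?thesis
      using tail[of j M] tail[of j M'] assms(3)[of j] assms(3)[of "Suc j"] by simp
  qed
qed

text \<open>A partition as a function of the row number, which is the form in which letter counts
  arrive. \<open>shape\<close> drops the empty rows, since \<open>is_partition\<close> wants
  positive ones.\<close>

locale row_counts =
  fixes N :: nat and c :: "nat \<Rightarrow> nat"
  assumes c_Suc_le: "c (Suc i) \<le> c i" and c_zero: "N \<le> i \<Longrightarrow> c i = 0"
begin

definition shape :: "nat list" where
  "shape = map c (filter (\<lambda>k. 0 < c k) [0..<N])"

lemma c_antimono: "i \<le> j \<Longrightarrow> c j \<le> c i"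
  using c_Suc_le by (rule lift_Suc_antimono_le)

lemma is_partition_shape: "is_partition shape"
proof -
  have "sorted_wrt (\<lambda>i j. c j \<le> c i) [0..<N]"
    by (rule sorted_wrt_mono_rel[of _ "(<)"]) (auto intro: c_antimono)
  then have "sorted_wrt (\<lambda>i j. c j \<le> c i) (filter (\<lambda>k. 0 < c k) [0..<N])"
    by (rule sorted_wrt_filter)
  then show ?thesis
    by (auto simp: is_partition_def shape_def sorted_wrt_map)
qed

lemma sum_list_shape: "sum_list shape = (\<Sum>k<N. c k)"
proof -
  have "sum_list (map c (filter (\<lambda>k. 0 < c k) xs)) = sum_list (map c xs)" for xs
    by (induction xs) auto
  then show ?thesis
    by (simp add: shape_def sum_list_distinct_conv_sum_set atLeast0LessThan)
qed

lemma column_lengths_shape: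
  "column_lengths shape = map (\<lambda>j. card {k. k < N \<and> j < c k}) [0..<c 0]"
proof -
  have first: "(case shape of [] \<Rightarrow> 0 | r # _ \<Rightarrow> r) = c 0"
  proof (cases "c 0 = 0")
    case True
    then have "c k = 0" for k
      using c_antimono[of 0 k] by simp
    then show ?thesis
      by (simp add: shape_def)
  next
    case False
    then have "[0..<N] = 0 # [1..<N]"
      using c_zero[of 0] by (metis One_nat_def not_le upt_rec neq0_conv)
    then show ?thesis
      using False by (simp add: shape_def)
  qed
  have "length (filter (\<lambda>r. j < r) shape) = card {k. k < N \<and> j < c k}" for j
  proof -
    have "length (filter (\<lambda>r. j < r) shape) = length (filter (\<lambda>k. j < c k) [0..<N])"
      by (simp add: shape_def filter_map o_def) (metis (mono_tags, lifting) gr0I less_nat_zero_code)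
    also have "\<dots> = card (set (filter (\<lambda>k. j < c k) [0..<N]))"
      by (intro distinct_card[symmetric]) simp
    also have "set (filter (\<lambda>k. j < c k) [0..<N]) = {k. k < N \<and> j < c k}"
      by auto
    finally show ?thesis .
  qed
  then show ?thesis
    by (simp add: column_lengths_def first)
qed

text \<open>Duality of conjugate partitions: as \<open>c\<close> decreases, the rows longer than
  \<open>i\<close> form an initial segment of the row numbers.\<close>

lemma less_card_column: "j < card {k. k < N \<and> i < c k} \<longleftrightarrow> i < c j"
proof
  assume "i < c j"
  then have "{..j} \<subseteq> {k. k < N \<and> i < c k}"
    using c_antimono c_zero by (auto simp: not_le[symmetric]) (metis le_trans less_le_trans not_le less_zeroE)+
  then have "card {..j} \<le> card {k. k < N \<and> i < c k}"
    by (intro card_mono) auto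
  then show "j < card {k. k < N \<and> i < c k}"
    by simp
next
  assume j: "j < card {k. k < N \<and> i < c k}"
  show "i < c j"
  proof (rule ccontr)
    assume "\<not> i < c j"
    then have "{k. k < N \<and> i < c k} \<subseteq> {..<j}"
      using c_antimono by (auto simp: not_less) (meson leD le_trans not_le_imp_less)
    then have "card {k. k < N \<and> i < c k} \<le> card {..<j}"
      by (intro card_mono) auto
    with j show False by simp
  qed
qed

text \<open>Conjugating twice gives back the row lengths.\<close>

lemma tail_column_lengths_shape:
  "size (filter_mset (\<lambda>x. j < x) (mset (column_lengths shape))) = c j"
proof -
  have "size (filter_mset (\<lambda>x. j < x) (mset (column_lengths shape))) = length (filter (\<lambda>i. i < c j) [0..<c 0])"
    unfolding mset_filter[symmetric] size_mset
    by (simp add: column_lengths_shape filter_map o_def less_card_column)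
  also have "\<dots> = card (set (filter (\<lambda>i. i < c j) [0..<c 0]))"
    by (intro distinct_card[symmetric]) simp
  also have "set (filter (\<lambda>i. i < c j) [0..<c 0]) = {..<c j}"
    using c_antimono[of 0 j] by auto
  finally show ?thesis by simp
qed

lemma zero_notin_column_lengths_shape: "0 \<notin> set (column_lengths shape)"
proof
  assume "0 \<in> set (column_lengths shape)"
  then obtain j where "j < c 0" and "0 = card {k. k < N \<and> j < c k}"
    unfolding column_lengths_shape set_map set_upt by (metis (no_types, lifting) atLeastLessThan_iff imageE)
  then show False
    using less_card_column[of 0 j] by linarith
qed

lemma column_lengths_shape_sorted: "sorted_wrt (\<ge>) (column_lengths shape)"
proof -
  have "sorted_wrt (\<lambda>i j. card {k. k < N \<and> j < c k} \<le> card {k. k < N \<and> i < c k}) [0..<c 0]"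
    by (rule sorted_wrt_mono_rel[of _ "(<)"]) (auto intro!: card_mono)
  then show ?thesis
    by (simp add: column_lengths_shape sorted_wrt_map)
qed

end

abbreviation word_count :: "nat \<Rightarrow> (nat \<Rightarrow> nat) \<Rightarrow> nat \<Rightarrow> nat" where
  "word_count N \<kappa> k \<equiv> card {x \<in> {1..N}. \<kappa> x = k}"

lemma inj_on_set_strict: "(\<And>b. b \<in> Q \<Longrightarrow> sorted_wrt (<) (b :: nat list)) \<Longrightarrow> inj_on set Q"
  by (metis inj_onI sorted_list_of_set_strict)

text \<open>The block lengths of \<open>Q\<close> and the column lengths of the shape have the same
  tails, namely the letter counts of \<kappa>.\<close>

lemma noncrossing_matching_tableau:
  assumes Q: "noncrossing_matching N \<kappa> Q"
    and bound: "\<And>x. x \<in> {1..N} \<Longrightarrow> \<kappa> x < N"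
    and rows: "row_counts N (word_count N \<kappa>)"
  shows "multfree_noncrossing_tableau (row_counts.shape N (word_count N \<kappa>)) (set ` Q)"
    and "image_mset length (mset_set Q) = mset (column_lengths (row_counts.shape N (word_count N \<kappa>)))"
proof -
  interpret row_counts N "word_count N \<kappa>" by fact
  note D = noncrossing_matchingD[OF Q]
  have tail: "size (filter_mset (\<lambda>x. j < x) (image_mset length (mset_set Q))) = word_count N \<kappa> j" for j
    using D(1) noncrossing_matching_letter_count[OF Q, of j] by (simp add: filter_mset_image_mset o_def)
  show lengths: "image_mset length (mset_set Q) = mset (column_lengths shape)"
  proof (rule multiset_eq_of_tails)
    show "0 \<notin># image_mset length (mset_set Q)"
      using D(1,2) by auto
    show "0 \<notin># mset (column_lengths shape)"
      using zero_notin_column_lengths_shape by simp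
  qed (simp only: tail tail_column_lengths_shape)
  have "(\<Sum>k<N. word_count N \<kappa> k) = (\<Sum>k\<in>{..<N}. \<Sum>x\<in>{x \<in> {1..N}. \<kappa> x = k}. 1)"
    by simp
  also have "\<dots> = (\<Sum>x\<in>{1..N}. 1)"
    using bound by (intro sum.group) auto
  also have "\<dots> = N"
    by simp
  finally have sum: "sum_list shape = N"
    by (simp only: sum_list_shape)
  have "partition_on {1..N} (set ` Q)"
    using D(2,5,7) by (auto simp: partition_on_def disjoint_def)
  moreover have "noncrossing_sets a b" if "a \<in> set ` Q" "b \<in> set ` Q" "a \<noteq> b" "card b \<le> card a" for a b
    using that D(3,6) by (auto simp: card_set_strict intro!: noncrossing_sets_of_arcs_ok)
  moreover have "image_mset card (mset_set (set ` Q)) = image_mset length (mset_set Q)"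
  proof -
    have "mset_set (set ` Q) = image_mset set (mset_set Q)"
      using D(3) by (intro image_mset_mset_set[symmetric] inj_on_set_strict)
    then show ?thesis
      using D(1,3) by (auto simp: multiset.map_comp card_set_strict intro!: image_mset_cong)
  qed
  ultimately show "multfree_noncrossing_tableau shape (set ` Q)"
    unfolding multfree_noncrossing_tableau_def sum lengths[symmetric] by blast
qed

subsection \<open>The substitution X = YZ\<close>

text \<open>For $f = \sum_\sigma f_\sigma \prod_i x_{i,\sigma(i)}$ this is the coefficient of
  $\prod_i y_{i,\kappa(i)} \prod_j z_{\kappa'(j),j}$ in $f(YZ)$.\<close>

definition word_transform :: "nat \<Rightarrow> ((nat \<Rightarrow> nat) \<Rightarrow> complex) \<Rightarrow> (nat \<Rightarrow> nat) \<Rightarrow> (nat \<Rightarrow> nat) \<Rightarrow> complex" where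
  "word_transform N f \<kappa> \<kappa>' =
     (\<Sum>\<sigma> | \<sigma> permutes {1..N}. if \<forall>x\<in>{1..N}. \<kappa> x = \<kappa>' (\<sigma> x) then f \<sigma> else 0)"

lemma word_transform_nonzeroE:
  assumes "word_transform N f \<kappa> \<kappa>' \<noteq> 0"
  obtains \<sigma> where "\<sigma> permutes {1..N}" "\<forall>x\<in>{1..N}. \<kappa> x = \<kappa>' (\<sigma> x)" "f \<sigma> \<noteq> 0"
proof -
  from assms obtain \<sigma> where "\<sigma> \<in> {\<sigma>. \<sigma> permutes {1..N}}"
    "(if \<forall>x\<in>{1..N}. \<kappa> x = \<kappa>' (\<sigma> x) then f \<sigma> else 0) \<noteq> 0"
    unfolding word_transform_def by (rule sum.not_neutral_contains_not_neutral)
  then show thesis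
    by (intro that[of \<sigma>]) (auto split: if_splits)
qed

lemma word_transform_cong:
  assumes "\<And>x. x \<in> {1..N} \<Longrightarrow> \<kappa> x = \<mu> x" "\<And>x. x \<in> {1..N} \<Longrightarrow> \<kappa>' x = \<mu>' x"
  shows "word_transform N f \<kappa> \<kappa>' = word_transform N f \<mu> \<mu>'"
  unfolding word_transform_def
proof (intro sum.cong refl)
  fix \<sigma> assume "\<sigma> \<in> {\<sigma>. \<sigma> permutes {1..N}}"
  then have "\<sigma> x \<in> {1..N}" if "x \<in> {1..N}" for x
    using that by (simp only: mem_Collect_eq permutes_in_image)
  then show "(if \<forall>x\<in>{1..N}. \<kappa> x = \<kappa>' (\<sigma> x) then f \<sigma> else 0) =
      (if \<forall>x\<in>{1..N}. \<mu> x = \<mu>' (\<sigma> x) then f \<sigma> else 0)"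
    using assms by simp
qed

lemma word_transform_diff_scale:
  "word_transform N (\<lambda>\<sigma>. f \<sigma> - c * g \<sigma>) \<kappa> \<kappa>' = word_transform N f \<kappa> \<kappa>' - c * word_transform N g \<kappa> \<kappa>'"
  unfolding word_transform_def sum_distrib_left sum_subtractf[symmetric]
  by (intro sum.cong) auto

lemma word_transform_sum_eq:
  assumes "word_transform N f \<kappa> \<kappa>' \<noteq> 0"
  shows "(\<Sum>x\<in>{1..N}. \<kappa> x) = (\<Sum>x\<in>{1..N}. \<kappa>' x)"
proof -
  obtain \<sigma> where \<sigma>: "\<sigma> permutes {1..N}" "\<forall>x\<in>{1..N}. \<kappa> x = \<kappa>' (\<sigma> x)" "f \<sigma> \<noteq> 0"
    using assms by (rule word_transform_nonzeroE)
  then have "(\<Sum>x\<in>{1..N}. \<kappa> x) = (\<Sum>x\<in>{1..N}. \<kappa>' (\<sigma> x))"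
    by (intro sum.cong) auto
  also have "\<dots> = (\<Sum>x\<in>{1..N}. \<kappa>' x)"
    using sum.permute[OF \<sigma>(1), of \<kappa>'] by (simp add: o_def)
  finally show ?thesis .
qed

text \<open>A nonzero coefficient comes from some \<sigma> that rearranges one word into the other.
  Equal letter counts will give the matchings of both words the same shape.\<close>

lemma word_transform_count_eq:
  assumes "word_transform N f \<kappa> \<kappa>' \<noteq> 0"
  shows "word_count N \<kappa> k = word_count N \<kappa>' k"
proof -
  obtain \<sigma> where \<sigma>: "\<sigma> permutes {1..N}" "\<forall>x\<in>{1..N}. \<kappa> x = \<kappa>' (\<sigma> x)" "f \<sigma> \<noteq> 0"
    using assms by (rule word_transform_nonzeroE)
  have "\<sigma> ` {x \<in> {1..N}. \<kappa> x = k} = {x \<in> {1..N}. \<kappa>' x = k}"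
  proof (intro equalityI subsetI)
    fix y assume "y \<in> {x \<in> {1..N}. \<kappa>' x = k}"
    then show "y \<in> \<sigma> ` {x \<in> {1..N}. \<kappa> x = k}"
      using \<sigma>(2)[rule_format, of "inv_into UNIV \<sigma> y"] permutes_in_image[OF permutes_inv[OF \<sigma>(1)], of y]
      by (intro image_eqI[of _ _ "inv_into UNIV \<sigma> y"]) (auto simp: permutes_inverses[OF \<sigma>(1)])
  qed (use \<sigma> permutes_in_image[OF \<sigma>(1)] in auto)
  moreover have "inj_on \<sigma> {x \<in> {1..N}. \<kappa> x = k}"
    using \<sigma>(1) by (rule permutes_inj_on)
  ultimately show ?thesis
    using card_image[of \<sigma> "{x \<in> {1..N}. \<kappa> x = k}"] by argo
qed

text \<open>Invariance of $f(YZ)$ under $(Y, Z) \mapsto (Yg, g^{-1}Z)$ for infinitesimal elementary $g$.\<close>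

lemma word_transform_exchange:
  "(\<Sum>i | i \<in> {1..N} \<and> \<kappa> i = k. word_transform N f (\<kappa>(i := l)) \<kappa>') =
   (\<Sum>j | j \<in> {1..N} \<and> \<kappa>' j = l. word_transform N f \<kappa> (\<kappa>'(j := k)))"
proof -
  let ?A = "{1..N}"
  \<comment> \<open>Both conditions say that \<open>\<kappa>\<close> and
    \<open>\<kappa>' \<circ> \<sigma>\<close> agree off \<open>i\<close>, where they take the values
    \<open>k\<close> and \<open>l\<close>. So the terms for \<open>i\<close> on the left and for
    \<open>\<sigma> i\<close> on the right correspond.\<close>
  have key: "(\<kappa> i = k \<and> (\<forall>x\<in>?A. (\<kappa>(i := l)) x = \<kappa>' (\<sigma> x))) =
      (\<kappa>' (\<sigma> i) = l \<and> (\<forall>x\<in>?A. \<kappa> x = (\<kappa>'(\<sigma> i := k)) (\<sigma> x)))"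
    if "\<sigma> permutes ?A" "i \<in> ?A" for \<sigma> i
  proof -
    have "\<sigma> x = \<sigma> i \<longleftrightarrow> x = i" for x
      using that(1) by (metis permutes_inverses(2))
    then show ?thesis
      using that(2) by (auto split: if_splits)
  qed
  have restrict: "(\<Sum>i | i \<in> ?A \<and> P i. h i) = (\<Sum>i\<in>?A. if P i then h i else 0)" for P and h :: "nat \<Rightarrow> complex"
    using sum.inter_filter[of ?A h P] by simp
  have "(\<Sum>i | i \<in> ?A \<and> \<kappa> i = k. word_transform N f (\<kappa>(i := l)) \<kappa>') =
    (\<Sum>\<sigma> | \<sigma> permutes ?A. \<Sum>i\<in>?A. if \<kappa> i = k \<and> (\<forall>x\<in>?A. (\<kappa>(i := l)) x = \<kappa>' (\<sigma> x)) then f \<sigma> else 0)"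
    unfolding restrict word_transform_def by (subst sum.swap) (auto intro!: sum.cong)
  also have "\<dots> = (\<Sum>\<sigma> | \<sigma> permutes ?A. \<Sum>i\<in>?A.
      if \<kappa>' (\<sigma> i) = l \<and> (\<forall>x\<in>?A. \<kappa> x = (\<kappa>'(\<sigma> i := k)) (\<sigma> x)) then f \<sigma> else 0)"
    by (intro sum.cong refl) (simp only: key mem_Collect_eq)
  also have "\<dots> = (\<Sum>\<sigma> | \<sigma> permutes ?A. \<Sum>j\<in>?A.
      if \<kappa>' j = l \<and> (\<forall>x\<in>?A. \<kappa> x = (\<kappa>'(j := k)) (\<sigma> x)) then f \<sigma> else 0)"
  proof (rule sum.cong[OF refl])
    fix \<sigma> assume "\<sigma> \<in> {\<sigma>. \<sigma> permutes ?A}"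
    then show "(\<Sum>i\<in>?A. if \<kappa>' (\<sigma> i) = l \<and> (\<forall>x\<in>?A. \<kappa> x = (\<kappa>'(\<sigma> i := k)) (\<sigma> x)) then f \<sigma> else 0) =
        (\<Sum>j\<in>?A. if \<kappa>' j = l \<and> (\<forall>x\<in>?A. \<kappa> x = (\<kappa>'(j := k)) (\<sigma> x)) then f \<sigma> else 0)"
      using sum.permute[of \<sigma> ?A "\<lambda>j. if \<kappa>' j = l \<and> (\<forall>x\<in>?A. \<kappa> x = (\<kappa>'(j := k)) (\<sigma> x)) then f \<sigma> else 0"]
      by (simp add: o_def)
  qed
  also have "\<dots> = (\<Sum>j | j \<in> ?A \<and> \<kappa>' j = l. word_transform N f \<kappa> (\<kappa>'(j := k)))"
    unfolding restrict word_transform_def by (subst sum.swap) (auto intro!: sum.cong)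
  finally show ?thesis .
qed

subsection \<open>Leading terms of bideterminants\<close>

definition preserves :: "nat list set \<Rightarrow> (nat \<Rightarrow> nat) \<Rightarrow> bool" where
  "preserves Q \<tau> \<longleftrightarrow> (\<forall>b\<in>Q. \<tau> ` set b \<subseteq> set b)"

text \<open>The coefficients $f_\sigma$ of the product of the minors with rows \<open>b\<close> and columns
  \<open>map \<sigma>\<^sub>0 b\<close>, for \<open>b \<in> Q\<close>.\<close>

definition block_alternator :: "nat list set \<Rightarrow> (nat \<Rightarrow> nat) \<Rightarrow> (nat \<Rightarrow> nat) \<Rightarrow> complex" where
  "block_alternator Q \<sigma>\<^sub>0 \<sigma> = (if preserves Q (inv_into UNIV \<sigma>\<^sub>0 \<circ> \<sigma>) then of_int (sign (inv_into UNIV \<sigma>\<^sub>0 \<circ> \<sigma>)) else 0)"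

lemma sum_permutes_shift:
  assumes "\<sigma>\<^sub>0 permutes A"
  shows "(\<Sum>\<sigma> | \<sigma> permutes A. h \<sigma>) = (\<Sum>\<tau> | \<tau> permutes A. h (\<sigma>\<^sub>0 \<circ> \<tau>))"
proof (rule sum.reindex_bij_witness[where i = "\<lambda>\<tau>. \<sigma>\<^sub>0 \<circ> \<tau>" and j = "\<lambda>\<sigma>. inv_into UNIV \<sigma>\<^sub>0 \<circ> \<sigma>"])
  fix \<sigma>
  show "\<sigma>\<^sub>0 \<circ> (inv_into UNIV \<sigma>\<^sub>0 \<circ> \<sigma>) = \<sigma>" "inv_into UNIV \<sigma>\<^sub>0 \<circ> (\<sigma>\<^sub>0 \<circ> \<sigma>) = \<sigma>" "h (\<sigma>\<^sub>0 \<circ> (inv_into UNIV \<sigma>\<^sub>0 \<circ> \<sigma>)) = h \<sigma>"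
    using permutes_inv_o[OF assms] by (auto simp flip: comp_assoc)
qed (use assms in \<open>auto intro!: permutes_compose permutes_inv\<close>)

lemma block_alternator_shift:
  assumes "\<sigma>\<^sub>0 permutes A"
  shows "block_alternator Q \<sigma>\<^sub>0 (\<sigma>\<^sub>0 \<circ> \<tau>) = (if preserves Q \<tau> then of_int (sign \<tau>) else 0)"
  using permutes_inv_o(2)[OF assms] by (simp add: block_alternator_def flip: comp_assoc)

lemma word_transform_block_alternator:
  assumes "\<sigma>\<^sub>0 permutes {1..N}"
  shows "word_transform N (block_alternator Q \<sigma>\<^sub>0) \<kappa> \<kappa>' =
    (\<Sum>\<tau> | \<tau> permutes {1..N}. if preserves Q \<tau> \<and> (\<forall>x\<in>{1..N}. \<kappa> x = \<kappa>' (\<sigma>\<^sub>0 (\<tau> x))) then of_int (sign \<tau>) else 0)"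
  unfolding word_transform_def
  by (subst sum_permutes_shift[OF assms], intro sum.cong refl) (simp add: block_alternator_shift[OF assms])

text \<open>If two positions of a block carry the same letter, composing \<tau> with their
  transposition reverses the sign and keeps both conditions, so the terms cancel in pairs.\<close>

lemma word_transform_block_alternator_inj:
  assumes "\<sigma>\<^sub>0 permutes {1..N}" and Q: "noncrossing_matching N \<rho> Q"
    and nz: "word_transform N (block_alternator Q \<sigma>\<^sub>0) \<kappa> \<kappa>' \<noteq> 0" and b: "b \<in> Q"
  shows "inj_on \<kappa> (set b)"
proof (rule inj_onI, rule ccontr)
  fix x y assume xy: "x \<in> set b" "y \<in> set b" "\<kappa> x = \<kappa> y" "x \<noteq> y"
  let ?A = "{1..N}"
  define t where "t = Transposition.transpose x y"
  define g :: "(nat \<Rightarrow> nat) \<Rightarrow> complex" where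
    "g \<tau> = (if preserves Q \<tau> \<and> (\<forall>x\<in>?A. \<kappa> x = \<kappa>' (\<sigma>\<^sub>0 (\<tau> x))) then of_int (sign \<tau>) else 0)" for \<tau>
  note D = noncrossing_matchingD[OF Q]
  have xyA: "x \<in> ?A" "y \<in> ?A"
    using D(7) b xy by blast+
  then have tA: "t permutes ?A"
    unfolding t_def by (rule permutes_swap_id)
  have tt: "t (t z) = z" for z
    by (simp add: t_def)
  have \<kappa>t: "\<kappa> (t z) = \<kappa> z" for z
    using xy by (simp add: t_def Transposition.transpose_def)
  have t_block: "t z \<in> set c" if "c \<in> Q" "z \<in> set c" for c z
  proof (cases "c = b")
    case True
    then show ?thesis
      using xy that by (simp add: t_def Transposition.transpose_def)
  next
    case False
    then have "z \<noteq> x" "z \<noteq> y"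
      using D(5)[OF that(1) b False] xy that(2) by auto
    then show ?thesis
      using that(2) by (simp add: t_def)
  qed
  have pres: "preserves Q (\<tau> \<circ> t)" if "preserves Q \<tau>" for \<tau>
    using that t_block by (fastforce simp: preserves_def)
  have comp_tt: "\<tau> \<circ> t \<circ> t = \<tau>" for \<tau> :: "nat \<Rightarrow> nat"
    using tt by (simp add: fun_eq_iff)
  have words: "\<forall>z\<in>?A. \<kappa> z = \<kappa>' (\<sigma>\<^sub>0 ((\<tau> \<circ> t) z))" if "\<forall>z\<in>?A. \<kappa> z = \<kappa>' (\<sigma>\<^sub>0 (\<tau> z))" for \<tau>
    using that \<kappa>t permutes_in_image[OF tA] by (metis comp_apply)
  have "g (\<tau> \<circ> t) = - g \<tau>" if \<tau>: "\<tau> permutes ?A" for \<tau>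
  proof -
    have "preserves Q (\<tau> \<circ> t) \<longleftrightarrow> preserves Q \<tau>"
      using pres[of \<tau>] pres[of "\<tau> \<circ> t"] by (auto simp: comp_tt)
    moreover have "(\<forall>z\<in>?A. \<kappa> z = \<kappa>' (\<sigma>\<^sub>0 ((\<tau> \<circ> t) z))) \<longleftrightarrow> (\<forall>z\<in>?A. \<kappa> z = \<kappa>' (\<sigma>\<^sub>0 (\<tau> z)))"
      using words[of \<tau>] words[of "\<tau> \<circ> t", unfolded comp_tt] by (rule iffI[rotated])
    moreover have "sign (\<tau> \<circ> t) = - sign \<tau>"
    proof -
      have "permutation \<tau>" "permutation t"
        using \<tau> tA permutation_permutes finite_atLeastAtMost by blast+
      then show ?thesis
        using xy(4) by (simp add: sign_compose t_def sign_swap_id)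
    qed
    ultimately show ?thesis
      by (simp only: g_def of_int_minus if_distrib[of uminus] minus_zero)
  qed
  then have "(\<Sum>\<tau> | \<tau> permutes ?A. g (\<tau> \<circ> t)) = - (\<Sum>\<tau> | \<tau> permutes ?A. g \<tau>)"
    by (simp add: sum_negf)
  moreover have "(\<Sum>\<tau> | \<tau> permutes ?A. g (\<tau> \<circ> t)) = (\<Sum>\<tau> | \<tau> permutes ?A. g \<tau>)"
    by (rule sum.reindex_bij_witness[where i = "\<lambda>\<tau>. \<tau> \<circ> t" and j = "\<lambda>\<tau>. \<tau> \<circ> t"])
      (use tA in \<open>auto simp: comp_tt intro: permutes_compose\<close>)
  ultimately have "(\<Sum>\<tau> | \<tau> permutes ?A. g \<tau>) = 0"
    by simp
  then show False
    using nz unfolding word_transform_block_alternator[OF assms(1)] g_def by simp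
qed

lemma sum_over_blocks:
  assumes "noncrossing_matching N \<rho> Q"
  shows "(\<Sum>x\<in>{1..N}. h x) = (\<Sum>b\<in>Q. \<Sum>x\<in>set b. h x)"
proof -
  note D = noncrossing_matchingD[OF assms]
  show ?thesis
    unfolding D(7)[symmetric] using D(1,5) by (intro sum.UNION_disjoint) auto
qed

lemma rank_image:
  assumes "noncrossing_matching N \<rho> Q" "b \<in> Q"
  shows "\<rho> ` set b = {..<length b}"
  using noncrossing_matchingD(4)[OF assms(1,2)]
  by (auto simp: set_conv_nth image_iff) (metis lessThan_iff)

text \<open>Distinct letters on a block of length \<open>l\<close> sum to at least
  \<open>0 + ... + (l - 1)\<close>. If the total sum is minimal, every block carries exactly these
  letters, and increasing order within the blocks makes the word colexicographically
  largest.\<close>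

lemma rank_word_extremal:
  assumes Q: "noncrossing_matching N \<rho> Q" and inj: "\<And>b. b \<in> Q \<Longrightarrow> inj_on \<kappa> (set b)"
  shows "(\<Sum>x\<in>{1..N}. \<rho> x) \<le> (\<Sum>x\<in>{1..N}. \<kappa> x)"
    and "(\<Sum>x\<in>{1..N}. \<kappa> x) = (\<Sum>x\<in>{1..N}. \<rho> x) \<Longrightarrow> x \<in> {1..N} \<Longrightarrow> \<kappa> x \<noteq> \<rho> x \<Longrightarrow>
      (\<And>y. y \<in> {1..N} \<Longrightarrow> x < y \<Longrightarrow> \<kappa> y = \<rho> y) \<Longrightarrow> \<kappa> x < \<rho> x"
proof -
  note D = noncrossing_matchingD[OF Q]
  have card: "card (\<kappa> ` set b) = length b" if "b \<in> Q" for b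
    using card_image[OF inj[OF that]] card_set_strict[OF D(3)[OF that]] by simp
  have rank_inj: "inj_on \<rho> (set b)" if "b \<in> Q" for b
    using rank_image[OF Q that] card_set_strict[OF D(3)[OF that]] by (simp add: eq_card_imp_inj_on)
  have sum\<rho>: "(\<Sum>x\<in>set b. \<rho> x) = \<Sum>{..<length b}" if "b \<in> Q" for b
    using sum.reindex[OF rank_inj[OF that], of "\<lambda>x. x"] rank_image[OF Q that] by simp
  have sum\<kappa>: "(\<Sum>x\<in>set b. \<kappa> x) = \<Sum>(\<kappa> ` set b)" if "b \<in> Q" for b
    using sum.reindex[OF inj[OF that], of "\<lambda>x. x"] by simp
  have le: "(\<Sum>x\<in>set b. \<rho> x) \<le> (\<Sum>x\<in>set b. \<kappa> x)" if "b \<in> Q" for b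
    using sum_card_le_sum(1)[of "\<kappa> ` set b"] card[OF that] by (simp add: sum\<rho>[OF that] sum\<kappa>[OF that])
  then show "(\<Sum>x\<in>{1..N}. \<rho> x) \<le> (\<Sum>x\<in>{1..N}. \<kappa> x)"
    unfolding sum_over_blocks[OF Q] by (rule sum_mono)
  assume eq: "(\<Sum>x\<in>{1..N}. \<kappa> x) = (\<Sum>x\<in>{1..N}. \<rho> x)" and x: "x \<in> {1..N}" "\<kappa> x \<noteq> \<rho> x"
    and later: "\<And>y. y \<in> {1..N} \<Longrightarrow> x < y \<Longrightarrow> \<kappa> y = \<rho> y"
  have "x \<in> (\<Union>b\<in>Q. set b)"
    using x(1) by (simp only: D(7))
  then obtain b i where b: "b \<in> Q" "i < length b" "x = b ! i"
    by (auto simp: in_set_conv_nth)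
  have "(\<Sum>x\<in>set b. \<kappa> x) \<le> (\<Sum>x\<in>set b. \<rho> x)"
  proof (rule ccontr)
    assume "\<not> ?thesis"
    then have "(\<Sum>b\<in>Q. \<Sum>x\<in>set b. \<rho> x) < (\<Sum>b\<in>Q. \<Sum>x\<in>set b. \<kappa> x)"
      using b(1) le D(1) by (intro sum_strict_mono_ex1) (auto simp: not_le)
    with eq show False
      unfolding sum_over_blocks[OF Q] by simp
  qed
  with le[OF b(1)] have "\<Sum>(\<kappa> ` set b) = \<Sum>{..<card (\<kappa> ` set b)}"
    using card[OF b(1)] by (simp add: sum\<rho>[OF b(1)] sum\<kappa>[OF b(1)])
  then have image: "\<kappa> ` set b = {..<length b}"
    using sum_card_le_sum(2)[of "\<kappa> ` set b"] card[OF b(1)] by simp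
  show "\<kappa> x < \<rho> x"
  proof (rule ccontr)
    assume "\<not> \<kappa> x < \<rho> x"
    then have gt: "i < \<kappa> x"
      using x(2) D(4)[OF b(1,2)] b(3) by simp
    have "b ! i \<in> set b"
      using b(2) by simp
    then have lt: "\<kappa> x < length b"
      using image b(3) by blast
    \<comment> \<open>The entry in row \<open>\<kappa> x\<close> of the block lies to the right of
      \<open>x\<close>, where \<kappa> agrees with \<rho>. It thus carries the letter
      \<open>\<kappa> x\<close> a second time.\<close>
    define y where "y = b ! \<kappa> x"
    have "x < y"
      using D(3)[OF b(1)] gt lt b(3) by (simp add: y_def sorted_wrt_nth_less)
    have yb: "y \<in> set b"
      using lt by (simp add: y_def)
    then have "y \<in> {1..N}"
      using D(7) b(1) by blast
    then have "\<kappa> y = \<rho> y"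
      using later \<open>x < y\<close> by blast
    also have "\<rho> y = \<kappa> x"
      unfolding y_def using D(4)[OF b(1) lt] .
    finally show False
      using inj[OF b(1)] yb \<open>x < y\<close> b(2,3) by (metis inj_onD nth_mem order_less_irrefl)
  qed
qed

text \<open>Only the identity contributes: a block has one entry per row, so a \<tau> that preserves
  blocks and row numbers fixes every position.\<close>

lemma word_transform_block_alternator_leading:
  assumes \<sigma>\<^sub>0: "\<sigma>\<^sub>0 permutes {1..N}" and Q: "noncrossing_matching N \<rho> Q"
    and Q': "noncrossing_matching N \<rho>' (map \<sigma>\<^sub>0 ` Q)"
  shows "word_transform N (block_alternator Q \<sigma>\<^sub>0) \<rho> \<rho>' = 1"
proof -
  note D = noncrossing_matchingD[OF Q]
  define g :: "(nat \<Rightarrow> nat) \<Rightarrow> complex" where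
    "g \<tau> = (if preserves Q \<tau> \<and> (\<forall>x\<in>{1..N}. \<rho> x = \<rho>' (\<sigma>\<^sub>0 (\<tau> x))) then of_int (sign \<tau>) else 0)" for \<tau>
  have rank': "\<rho>' (\<sigma>\<^sub>0 (b ! i)) = i" if "b \<in> Q" "i < length b" for b i
    using noncrossing_matchingD(4)[OF Q', of "map \<sigma>\<^sub>0 b" i] that by simp
  have pos: "\<exists>b\<in>Q. \<exists>i<length b. x = b ! i" if "x \<in> {1..N}" for x
  proof -
    have "x \<in> (\<Union>b\<in>Q. set b)"
      using that by (simp only: D(7))
    then show ?thesis
      by (auto simp: in_set_conv_nth)
  qed
  have "g \<tau> = 0" if \<tau>: "\<tau> permutes {1..N}" "\<tau> \<noteq> id" for \<tau>
  proof (rule ccontr)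
    assume "g \<tau> \<noteq> 0"
    then have pres: "preserves Q \<tau>" and words: "\<And>x. x \<in> {1..N} \<Longrightarrow> \<rho> x = \<rho>' (\<sigma>\<^sub>0 (\<tau> x))"
      by (auto simp: g_def split: if_splits)
    have "\<tau> x = x" for x
    proof (cases "x \<in> {1..N}")
      case True
      with pos obtain b i where b: "b \<in> Q" "i < length b" "x = b ! i"
        by blast
      then have "\<tau> x \<in> set b"
        using pres nth_mem[OF b(2)] by (auto simp: preserves_def image_subset_iff)
      then obtain j where j: "j < length b" "\<tau> x = b ! j"
        by (auto simp: in_set_conv_nth)
      then have "i = j"
        using words[OF True] rank'[OF b(1) j(1)] D(4)[OF b(1,2)] b(3) by simp
      then show ?thesis
        using b j by simp
    qed (use \<tau> in \<open>auto simp: permutes_def\<close>)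
    then show False
      using \<tau>(2) by auto
  qed
  then have "(\<Sum>\<tau> | \<tau> permutes {1..N}. g \<tau>) = (\<Sum>\<tau>\<in>{id}. g \<tau>)"
    by (intro sum.mono_neutral_right) (auto simp: finite_permutations permutes_id)
  moreover have "g id = 1"
  proof -
    have "\<rho> x = \<rho>' (\<sigma>\<^sub>0 x)" if "x \<in> {1..N}" for x
      using pos[OF that] rank' D(4) by auto
    then show ?thesis
      by (simp add: g_def preserves_def)
  qed
  ultimately show ?thesis
    unfolding word_transform_block_alternator[OF \<sigma>\<^sub>0] g_def by simp
qed

text \<open>Some block-preserving \<tau> contributes, and it makes \<open>\<kappa>\<close> agree
  with \<open>\<kappa>' \<circ> \<sigma>\<^sub>0 \<circ> \<tau>\<close>. Injectivity of \<kappa> on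
  a block therefore passes to \<kappa>' on the image block.\<close>

lemma word_transform_block_alternator_inj_right:
  assumes \<sigma>\<^sub>0: "\<sigma>\<^sub>0 permutes {1..N}" and Q: "noncrossing_matching N \<rho> Q"
    and nz: "word_transform N (block_alternator Q \<sigma>\<^sub>0) \<kappa> \<kappa>' \<noteq> 0" and b: "b \<in> map \<sigma>\<^sub>0 ` Q"
  shows "inj_on \<kappa>' (set b)"
proof -
  note D = noncrossing_matchingD[OF Q]
  obtain c where c: "c \<in> Q" "b = map \<sigma>\<^sub>0 c"
    using b by auto
  have "\<exists>\<tau>. \<tau> permutes {1..N} \<and> preserves Q \<tau> \<and> (\<forall>x\<in>{1..N}. \<kappa> x = \<kappa>' (\<sigma>\<^sub>0 (\<tau> x)))"
    using nz unfolding word_transform_block_alternator[OF \<sigma>\<^sub>0]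
    by (smt (verit, best) mem_Collect_eq sum.neutral)
  then obtain \<tau> where \<tau>: "\<tau> permutes {1..N}" "preserves Q \<tau>" "\<And>x. x \<in> {1..N} \<Longrightarrow> \<kappa> x = \<kappa>' (\<sigma>\<^sub>0 (\<tau> x))"
    by blast
  have "\<tau> ` set c = set c"
    using \<tau>(2) c(1) permutes_inj_on[OF \<tau>(1)] by (intro endo_inj_surj) (auto simp: preserves_def)
  then have img: "set b = (\<sigma>\<^sub>0 \<circ> \<tau>) ` set c"
    using c(2) by (metis image_comp set_map)
  have "inj_on (\<kappa>' \<circ> (\<sigma>\<^sub>0 \<circ> \<tau>)) (set c)"
  proof -
    have "inj_on \<kappa> (set c)"
      by (rule word_transform_block_alternator_inj[OF \<sigma>\<^sub>0 Q nz c(1)])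
    moreover have "\<kappa> x = (\<kappa>' \<circ> (\<sigma>\<^sub>0 \<circ> \<tau>)) x" if "x \<in> set c" for x
    proof -
      have "x \<in> {1..N}"
        using that D(7) c(1) by blast
      then show ?thesis
        using \<tau>(3) by simp
    qed
    ultimately show ?thesis
      by (metis (mono_tags, lifting) inj_on_cong)
  qed
  then show ?thesis
    unfolding img by (rule inj_on_imageI)
qed

subsection \<open>Induction on the leading term\<close>

text \<open>\<open>N\<close> letters are enough: no block has more than \<open>N\<close> entries,
  and an injective word exists, which is what isolates single coefficients of \<open>f\<close>. The
  bound also makes the keys bounded.\<close>

definition bounded_word :: "nat \<Rightarrow> (nat \<Rightarrow> nat) \<Rightarrow> bool" where
  "bounded_word N \<kappa> \<longleftrightarrow> (\<forall>x\<in>{1..N}. \<kappa> x < N)"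

text \<open>The letters of a bounded word are digits in base \<open>Suc N\<close> at the places 1 to
  \<open>N\<close>, so the number stays below \<open>Suc N ^ Suc N\<close>, the radix of
  \<open>word_key\<close>.\<close>

definition colex_number :: "nat \<Rightarrow> (nat \<Rightarrow> nat) \<Rightarrow> nat" where
  "colex_number N \<kappa> = (\<Sum>x\<in>{1..N}. \<kappa> x * Suc N ^ x)"

text \<open>The key orders pairs of words lexicographically: first by decreasing sum of the letters,
  then by the colexicographic order of the first and of the second word.\<close>

definition word_key :: "nat \<Rightarrow> (nat \<Rightarrow> nat) \<Rightarrow> (nat \<Rightarrow> nat) \<Rightarrow> nat" where
  "word_key N \<kappa> \<kappa>' = ((N * N - (\<Sum>x\<in>{1..N}. \<kappa> x)) * Suc N ^ Suc N + colex_number N \<kappa>) * Suc N ^ Suc N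
     + colex_number N \<kappa>'"

lemma colex_number_less:
  assumes "bounded_word N \<kappa>" "x \<in> {1..N}" "\<kappa> x < \<mu> x" "\<And>y. y \<in> {1..N} \<Longrightarrow> x < y \<Longrightarrow> \<kappa> y = \<mu> y"
  shows "colex_number N \<kappa> < colex_number N \<mu>"
  unfolding colex_number_def using assms
  by (intro colex_digit_sum_less[where x = x]) (auto simp: bounded_word_def less_Suc_eq)

lemma colex_number_bound:
  assumes "bounded_word N \<kappa>"
  shows "colex_number N \<kappa> < Suc N ^ Suc N"
  unfolding colex_number_def using assms
  by (intro digit_sum_less_on) (auto simp: bounded_word_def less_Suc_eq)

lemma lex_number_less:
  fixes a b :: nat
  assumes "a < b" "c < M"
  shows "a * M + c < b * M + d"
proof -
  have "a * M + M \<le> b * M"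
    using assms(1) by (metis Suc_leI add.commute mult_Suc mult_le_mono1)
  then show ?thesis
    using assms(2) by linarith
qed

lemma word_key_less_sum:
  assumes "bounded_word N \<kappa>" "bounded_word N \<kappa>'" "bounded_word N \<mu>"
    and "(\<Sum>x\<in>{1..N}. \<mu> x) < (\<Sum>x\<in>{1..N}. \<kappa> x)"
  shows "word_key N \<kappa> \<kappa>' < word_key N \<mu> \<mu>'"
proof -
  \<comment> \<open>This bound keeps the truncated subtraction in \<open>word_key\<close>
    exact.\<close>
  have "(\<Sum>x\<in>{1..N}. \<kappa> x) \<le> (\<Sum>x\<in>{1..N}. N)"
    using assms(1) by (intro sum_mono) (auto simp: bounded_word_def intro: less_imp_le)
  then have "(\<Sum>x\<in>{1..N}. \<kappa> x) \<le> N * N"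
    by simp
  then show ?thesis
    unfolding word_key_def using assms
    by (intro lex_number_less colex_number_bound) auto
qed

lemma word_key_less_left:
  assumes "bounded_word N \<kappa>'" "(\<Sum>x\<in>{1..N}. \<mu> x) = (\<Sum>x\<in>{1..N}. \<kappa> x)"
    and "colex_number N \<kappa> < colex_number N \<mu>"
  shows "word_key N \<kappa> \<kappa>' < word_key N \<mu> \<mu>'"
  unfolding word_key_def
  by (rule lex_number_less[OF _ colex_number_bound]) (use assms in auto)

lemma word_key_less_right:
  assumes "\<And>x. x \<in> {1..N} \<Longrightarrow> \<mu> x = \<kappa> x" "colex_number N \<kappa>' < colex_number N \<mu>'"
  shows "word_key N \<kappa> \<kappa>' < word_key N \<mu> \<mu>'"
proof -
  have "(\<Sum>x\<in>{1..N}. \<mu> x) = (\<Sum>x\<in>{1..N}. \<kappa> x)" "colex_number N \<mu> = colex_number N \<kappa>"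
    using assms(1) by (simp_all add: colex_number_def)
  then show ?thesis
    using assms(2) by (simp add: word_key_def)
qed

text \<open>A key belongs to a single pair of words on \<open>{1..N}\<close>, so that one
  subtraction clears the largest key.\<close>

lemma word_key_inj:
  assumes bd: "bounded_word N \<kappa>" "bounded_word N \<kappa>'" "bounded_word N \<mu>" "bounded_word N \<mu>'"
    and eq: "word_key N \<kappa> \<kappa>' = word_key N \<mu> \<mu>'" and x: "x \<in> {1..N}"
  shows "\<kappa> x = \<mu> x" "\<kappa>' x = \<mu>' x"
proof -
  have words: "colex_number N \<kappa> \<noteq> colex_number N \<mu>"
    if bd: "bounded_word N \<kappa>" "bounded_word N \<mu>" and ex: "\<exists>x\<in>{1..N}. \<kappa> x \<noteq> \<mu> x" for \<kappa> \<mu>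
  proof -
    obtain z where z: "z \<in> {1..N}" "\<kappa> z \<noteq> \<mu> z" "\<And>y. y \<in> {1..N} \<Longrightarrow> z < y \<Longrightarrow> \<kappa> y = \<mu> y"
      using last_difference[OF finite_atLeastAtMost ex] by blast
    show ?thesis
    proof (cases "\<kappa> z < \<mu> z")
      case True
      then show ?thesis
        using colex_number_less[OF bd(1) z(1) True z(3)] by simp
    next
      case False
      then have "\<mu> z < \<kappa> z"
        using z(2) by simp
      from colex_number_less[OF bd(2) z(1) this z(3)[symmetric]] show ?thesis
        by simp
    qed
  qed
  have sum: "(\<Sum>x\<in>{1..N}. \<mu> x) = (\<Sum>x\<in>{1..N}. \<kappa> x)"
    using word_key_less_sum[OF bd(1,2,3), of \<mu>'] word_key_less_sum[OF bd(3,4,1), of \<kappa>'] eq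
    by (cases rule: linorder_cases) auto
  have colex: "colex_number N \<kappa> = colex_number N \<mu>"
    using word_key_less_left[OF bd(2) sum, of \<mu>'] word_key_less_left[OF bd(4) sum[symmetric], of \<kappa>'] eq
    by (cases rule: linorder_cases) auto
  then have left: "\<kappa> x = \<mu> x" if "x \<in> {1..N}" for x
    using words[OF bd(1,3)] that by blast
  have "colex_number N \<kappa>' = colex_number N \<mu>'"
    using word_key_less_right[of N \<mu> \<kappa> \<kappa>' \<mu>'] word_key_less_right[of N \<kappa> \<mu> \<mu>' \<kappa>'] left eq
    by (cases rule: linorder_cases) auto
  then have "\<kappa>' x = \<mu>' x"
    using words[OF bd(2,4)] x by blast
  with left[OF x] show "\<kappa> x = \<mu> x" "\<kappa>' x = \<mu>' x" .
qed

lemma bounded_word_update: "bounded_word N \<kappa> \<Longrightarrow> k < N \<Longrightarrow> bounded_word N (\<kappa>(i := k))"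
  by (simp add: bounded_word_def)

text \<open>By \<open>word_transform_exchange\<close>, raising a letter on one side equals lowering
  one on the other. On either side the exchanged pairs have a first word of smaller sum than
  \<kappa>, hence a larger key, and their coefficients vanish. This is the hypothesis
  \<open>raise\<close> of \<open>leading_word_lattice\<close>.\<close>

lemma leading_pair_lattice:
  assumes bd: "bounded_word N \<kappa>" "bounded_word N \<kappa>'" and nz: "word_transform N f \<kappa> \<kappa>' \<noteq> 0"
    and lead: "\<And>\<mu> \<mu>'. bounded_word N \<mu> \<Longrightarrow> bounded_word N \<mu>' \<Longrightarrow> word_key N \<kappa> \<kappa>' < word_key N \<mu> \<mu>' \<Longrightarrow>
      word_transform N f \<mu> \<mu>' = 0"
  shows "card {x \<in> {1..N}. x \<le> m \<and> \<kappa> x = Suc k} \<le> card {x \<in> {1..N}. x \<le> m \<and> \<kappa> x = k}"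
    and "card {x \<in> {1..N}. x \<le> m \<and> \<kappa>' x = Suc k} \<le> card {x \<in> {1..N}. x \<le> m \<and> \<kappa>' x = k}"
proof -
  show "card {x \<in> {1..N}. x \<le> m \<and> \<kappa> x = Suc k} \<le> card {x \<in> {1..N}. x \<le> m \<and> \<kappa> x = k}"
  proof (rule leading_word_lattice[where G = "\<lambda>u. word_transform N f u \<kappa>'" and N = N])
    fix u assume u: "(\<Sum>x\<in>{1..N}. u x) < (\<Sum>x\<in>{1..N}. \<kappa> x)" "\<And>x. x \<in> {1..N} \<Longrightarrow> u x < N"
    then have bu: "bounded_word N u"
      by (simp add: bounded_word_def)
    have "word_transform N f u (\<kappa>'(j := k)) = 0" if "j \<in> {1..N} \<and> \<kappa>' j = Suc k" for j
    proof (rule lead[OF bu])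
      show "bounded_word N (\<kappa>'(j := k))"
        using that bd(2)[unfolded bounded_word_def, rule_format, of j] bd(2)
        by (intro bounded_word_update) auto
      show "word_key N \<kappa> \<kappa>' < word_key N u (\<kappa>'(j := k))"
        by (rule word_key_less_sum) (use bd bu u in auto)
    qed
    then show "(\<Sum>i | i \<in> {1..N} \<and> u i = k. word_transform N f (u(i := Suc k)) \<kappa>') = 0"
      unfolding word_transform_exchange by (intro sum.neutral) blast
  next
    fix u x
    assume x: "x \<in> {1..N}" "\<kappa> x < u x" and later: "\<And>y. y \<in> {1..N} \<Longrightarrow> x < y \<Longrightarrow> u y = \<kappa> y"
      and sum: "(\<Sum>x\<in>{1..N}. u x) = (\<Sum>x\<in>{1..N}. \<kappa> x)" and "\<And>y. y \<in> {1..N} \<Longrightarrow> u y < N"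
    then have "bounded_word N u"
      by (simp add: bounded_word_def)
    moreover have "word_key N \<kappa> \<kappa>' < word_key N u \<kappa>'"
      by (intro word_key_less_left bd sum colex_number_less[where x = x]) (use bd x later in auto)
    ultimately show "word_transform N f u \<kappa>' = 0"
      using bd by (intro lead)
  qed (use nz bd in \<open>auto simp: bounded_word_def\<close>)
  show "card {x \<in> {1..N}. x \<le> m \<and> \<kappa>' x = Suc k} \<le> card {x \<in> {1..N}. x \<le> m \<and> \<kappa>' x = k}"
  proof (rule leading_word_lattice[where G = "\<lambda>u. word_transform N f \<kappa> u" and N = N])
    fix u assume u: "\<And>x. x \<in> {1..N} \<Longrightarrow> u x < N"
    then have bu: "bounded_word N u"
      by (simp add: bounded_word_def)
    have "word_transform N f (\<kappa>(i := k)) u = 0" if i: "i \<in> {1..N} \<and> \<kappa> i = Suc k" for i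
    proof (rule lead[OF _ bu])
      show b: "bounded_word N (\<kappa>(i := k))"
        using i bd(1)[unfolded bounded_word_def, rule_format, of i] bd(1)
        by (intro bounded_word_update) auto
      have "(\<Sum>x\<in>{1..N}. (\<kappa>(i := k)) x) < (\<Sum>x\<in>{1..N}. \<kappa> x)"
        using i by (intro sum_strict_mono_ex1) auto
      then show "word_key N \<kappa> \<kappa>' < word_key N (\<kappa>(i := k)) u"
        by (intro word_key_less_sum bd b)
    qed
    then show "(\<Sum>j | j \<in> {1..N} \<and> u j = k. word_transform N f \<kappa> (u(j := Suc k))) = 0"
      unfolding word_transform_exchange[symmetric] by (intro sum.neutral) blast
  next
    fix u x
    assume x: "x \<in> {1..N}" "\<kappa>' x < u x" and later: "\<And>y. y \<in> {1..N} \<Longrightarrow> x < y \<Longrightarrow> u y = \<kappa>' y"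
      and "\<And>y. y \<in> {1..N} \<Longrightarrow> u y < N"
    then have "bounded_word N u"
      by (simp add: bounded_word_def)
    moreover have "word_key N \<kappa> \<kappa>' < word_key N \<kappa> u"
      by (intro word_key_less_right colex_number_less[where x = x]) (use bd x later in auto)
    ultimately show "word_transform N f \<kappa> u = 0"
      using bd by (intro lead)
  qed (use nz bd in \<open>auto simp: bounded_word_def\<close>)
qed

text \<open>For an injective word \<kappa>' and \<open>\<kappa> = \<kappa>' \<circ> \<sigma>\<close>
  only \<sigma> itself contributes. Subtracting 1 turns the positions \<open>1..N\<close> into the
  letters \<open>0..N-1\<close>.\<close>

lemma word_transform_zero_imp_zero:
  assumes zero: "\<And>\<kappa> \<kappa>'. bounded_word N \<kappa> \<Longrightarrow> bounded_word N \<kappa>' \<Longrightarrow> word_transform N f \<kappa> \<kappa>' = 0"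
    and \<sigma>: "\<sigma> permutes {1..N}"
  shows "f \<sigma> = 0"
proof -
  let ?\<kappa>' = "\<lambda>x. x - 1" and ?\<kappa> = "\<lambda>x. \<sigma> x - 1"
  have in_range: "\<tau> x \<in> {1..N}" if "\<tau> permutes {1..N}" "x \<in> {1..N}" for \<tau> x
    using that by (simp only: permutes_in_image)
  have "bounded_word N ?\<kappa>'" "bounded_word N ?\<kappa>"
    using in_range[OF \<sigma>] by (force simp: bounded_word_def)+
  then have "0 = word_transform N f ?\<kappa> ?\<kappa>'"
    using zero by simp
  also have "\<dots> = (\<Sum>\<tau> | \<tau> permutes {1..N}. if \<tau> = \<sigma> then f \<tau> else 0)"
    unfolding word_transform_def
  proof (intro sum.cong refl if_cong)
    fix \<tau> assume "\<tau> \<in> {\<tau>. \<tau> permutes {1..N}}"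
    then have \<tau>: "\<tau> permutes {1..N}"
      by simp
    show "(\<forall>x\<in>{1..N}. \<sigma> x - 1 = \<tau> x - 1) = (\<tau> = \<sigma>)"
    proof
      assume eq: "\<forall>x\<in>{1..N}. \<sigma> x - 1 = \<tau> x - 1"
      show "\<tau> = \<sigma>"
      proof
        fix x
        show "\<tau> x = \<sigma> x"
        proof (cases "x \<in> {1..N}")
          case True
          then show ?thesis
            using eq in_range[OF \<tau> True] in_range[OF \<sigma> True] by force
        next
          case False
          then show ?thesis
            using permutes_not_in[OF \<tau> False] permutes_not_in[OF \<sigma> False] by simp
        qed
      qed
    qed simp
  qed
  also have "\<dots> = f \<sigma>"
    using \<sigma> by (simp add: finite_permutations)
  finally show ?thesis ..
qed

text \<open>Extremality is applied to the sum, to the first word and to the second word in turn. The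
  sum of the second word comes for free, since both words of a nonzero coefficient have the same
  sum.\<close>

lemma block_alternator_below:
  assumes \<sigma>\<^sub>0: "\<sigma>\<^sub>0 permutes {1..N}" and Q: "noncrossing_matching N \<rho> Q"
    and Q': "noncrossing_matching N \<rho>' (map \<sigma>\<^sub>0 ` Q)"
    and bd: "bounded_word N \<rho>" "bounded_word N \<rho>'" "bounded_word N \<mu>" "bounded_word N \<mu>'"
    and key: "word_key N \<rho> \<rho>' \<le> word_key N \<mu> \<mu>'"
    and nz: "word_transform N (block_alternator Q \<sigma>\<^sub>0) \<mu> \<mu>' \<noteq> 0"
    and x: "x \<in> {1..N}"
  shows "\<mu> x = \<rho> x" "\<mu>' x = \<rho>' x"
proof -
  note inj = word_transform_block_alternator_inj[OF \<sigma>\<^sub>0 Q nz]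
    and inj' = word_transform_block_alternator_inj_right[OF \<sigma>\<^sub>0 Q nz]
  note ext = rank_word_extremal[OF Q inj] and ext' = rank_word_extremal[OF Q' inj']
  have sum: "(\<Sum>x\<in>{1..N}. \<mu> x) = (\<Sum>x\<in>{1..N}. \<rho> x)"
  proof (rule ccontr)
    assume "\<not> ?thesis"
    then have "(\<Sum>x\<in>{1..N}. \<rho> x) < (\<Sum>x\<in>{1..N}. \<mu> x)"
      using ext(1) by simp
    from word_key_less_sum[OF bd(3,4,1) this, of \<rho>'] key show False
      by simp
  qed
  have left: "\<mu> y = \<rho> y" if "y \<in> {1..N}" for y
  proof (rule ccontr)
    assume "\<mu> y \<noteq> \<rho> y"
    then have ex: "\<exists>y\<in>{1..N}. \<mu> y \<noteq> \<rho> y"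
      using that by blast
    obtain z where z: "z \<in> {1..N}" "\<mu> z \<noteq> \<rho> z" "\<And>y. y \<in> {1..N} \<Longrightarrow> z < y \<Longrightarrow> \<mu> y = \<rho> y"
      using last_difference[OF finite_atLeastAtMost ex] by blast
    have "colex_number N \<mu> < colex_number N \<rho>"
      using z by (intro colex_number_less[OF bd(3) z(1)] ext(2) sum) auto
    from word_key_less_left[OF bd(4) sum[symmetric] this, of \<rho>'] key show False
      by simp
  qed
  have nz1: "word_transform N (block_alternator Q \<sigma>\<^sub>0) \<rho> \<rho>' \<noteq> 0"
    by (simp add: word_transform_block_alternator_leading[OF \<sigma>\<^sub>0 Q Q'])
  have sum': "(\<Sum>x\<in>{1..N}. \<mu>' x) = (\<Sum>x\<in>{1..N}. \<rho>' x)"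
    using word_transform_sum_eq[OF nz] word_transform_sum_eq[OF nz1] sum by simp
  have right: "\<mu>' y = \<rho>' y" if "y \<in> {1..N}" for y
  proof (rule ccontr)
    assume "\<mu>' y \<noteq> \<rho>' y"
    then have ex: "\<exists>y\<in>{1..N}. \<mu>' y \<noteq> \<rho>' y"
      using that by blast
    obtain z where z: "z \<in> {1..N}" "\<mu>' z \<noteq> \<rho>' z" "\<And>y. y \<in> {1..N} \<Longrightarrow> z < y \<Longrightarrow> \<mu>' y = \<rho>' y"
      using last_difference[OF finite_atLeastAtMost ex] by blast
    have "colex_number N \<mu>' < colex_number N \<rho>'"
      using z by (intro colex_number_less[OF bd(4) z(1)] ext'(2) sum') auto
    from word_key_less_right[of N \<rho> \<mu>, OF left[symmetric] this] key show False
      by simp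
  qed
  show "\<mu> x = \<rho> x" "\<mu>' x = \<rho>' x"
    using left[OF x] right[OF x] .
qed

text \<open>\<open>P\<close> stands for membership of the associated polynomial in a subspace, so
  the induction can stay with coefficient functions. The premise \<open>noncrossing\<close> leaves
  the choice of \<open>\<sigma>\<^sub>0\<close>, that is, the pairing of the blocks, to the
  application.\<close>

lemma leading_pair_induction:
  fixes P :: "((nat \<Rightarrow> nat) \<Rightarrow> complex) \<Rightarrow> bool"
  assumes zero: "\<And>f. (\<And>\<sigma>. \<sigma> permutes {1..N} \<Longrightarrow> f \<sigma> = 0) \<Longrightarrow> P f"
    and closed: "\<And>f g c. P g \<Longrightarrow> P (\<lambda>\<sigma>. f \<sigma> - c * g \<sigma>) \<Longrightarrow> P f"
    and noncrossing: "\<And>\<rho> \<rho>' Q Q'. bounded_word N \<rho> \<Longrightarrow> bounded_word N \<rho>' \<Longrightarrow>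
      noncrossing_matching N \<rho> Q \<Longrightarrow> noncrossing_matching N \<rho>' Q' \<Longrightarrow>
      row_counts N (word_count N \<rho>) \<Longrightarrow> word_count N \<rho> = word_count N \<rho>' \<Longrightarrow>
      \<exists>\<sigma>\<^sub>0. \<sigma>\<^sub>0 permutes {1..N} \<and> Q' = map \<sigma>\<^sub>0 ` Q \<and> P (block_alternator Q \<sigma>\<^sub>0)"
  shows "P f"
proof -
  \<comment> \<open>\<open>n\<close> is a strict upper bound of the keys with nonzero coefficient;
    at 0 none are left.\<close>
  have "P f" if "\<And>\<mu> \<mu>'. bounded_word N \<mu> \<Longrightarrow> bounded_word N \<mu>' \<Longrightarrow> n \<le> word_key N \<mu> \<mu>' \<Longrightarrow>
      word_transform N f \<mu> \<mu>' = 0" for n f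
    using that
  proof (induction n arbitrary: f)
    case 0
    show ?case
    proof (rule zero)
      fix \<sigma> assume "\<sigma> permutes {1..N}"
      then show "f \<sigma> = 0"
        by (intro word_transform_zero_imp_zero[of N f \<sigma>]) (rule 0, simp_all)
    qed
  next
    case (Suc n)
    show ?case
    proof (cases "\<exists>\<kappa> \<kappa>'. bounded_word N \<kappa> \<and> bounded_word N \<kappa>' \<and> word_key N \<kappa> \<kappa>' = n \<and>
        word_transform N f \<kappa> \<kappa>' \<noteq> 0")
      case False
      show ?thesis
      proof (rule Suc.IH)
        fix \<mu> \<mu>' assume "bounded_word N \<mu>" "bounded_word N \<mu>'" "n \<le> word_key N \<mu> \<mu>'"
        then show "word_transform N f \<mu> \<mu>' = 0"
          using False Suc.prems[of \<mu> \<mu>'] by (cases "word_key N \<mu> \<mu>' = n") auto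
      qed
    next
      case True
      then obtain \<kappa> \<kappa>' where bd: "bounded_word N \<kappa>" "bounded_word N \<kappa>'"
        and key: "word_key N \<kappa> \<kappa>' = n" and nz: "word_transform N f \<kappa> \<kappa>' \<noteq> 0"
        by blast
      have lead: "word_transform N f \<mu> \<mu>' = 0"
        if "bounded_word N \<mu>" "bounded_word N \<mu>'" "word_key N \<kappa> \<kappa>' < word_key N \<mu> \<mu>'" for \<mu> \<mu>'
        using Suc.prems[OF that(1,2)] that(3) key by simp
      note lattice = leading_pair_lattice[OF bd nz lead]
      have prefix: "{x \<in> {1..N}. x \<le> m \<and> h x = k} = {x \<in> {1..m}. h x = k}" if "m \<le> N" for m k and h :: "nat \<Rightarrow> nat"
        using that by auto
      have "card {x \<in> {1..m}. \<kappa> x = Suc k} \<le> card {x \<in> {1..m}. \<kappa> x = k}" if "m \<le> N" for m k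
        using lattice(1)[of m k] unfolding prefix[OF that] .
      then obtain Q where Q: "noncrossing_matching N \<kappa> Q"
        using noncrossing_matching_exists by blast
      have "card {x \<in> {1..m}. \<kappa>' x = Suc k} \<le> card {x \<in> {1..m}. \<kappa>' x = k}" if "m \<le> N" for m k
        using lattice(2)[of m k] unfolding prefix[OF that] .
      then obtain Q' where Q': "noncrossing_matching N \<kappa>' Q'"
        using noncrossing_matching_exists by blast
      have "row_counts N (word_count N \<kappa>)"
      proof
        show "word_count N \<kappa> (Suc i) \<le> word_count N \<kappa> i" for i
          using lattice(1)[of N i] by (simp only: prefix[OF order_refl])
        show "word_count N \<kappa> i = 0" if "N \<le> i" for i
          using bd(1) that by (force simp: bounded_word_def)
      qed
      moreover have "word_count N \<kappa> = word_count N \<kappa>'"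
        using word_transform_count_eq[OF nz] by (rule ext)
      ultimately obtain \<sigma>\<^sub>0 where \<sigma>\<^sub>0: "\<sigma>\<^sub>0 permutes {1..N}" "Q' = map \<sigma>\<^sub>0 ` Q" "P (block_alternator Q \<sigma>\<^sub>0)"
        using noncrossing[OF bd Q Q'] by blast
      note Q'' = Q'[unfolded \<sigma>\<^sub>0(2)]
      let ?e = "block_alternator Q \<sigma>\<^sub>0"
      let ?c = "word_transform N f \<kappa> \<kappa>'"
      \<comment> \<open>The coefficient of \<open>?e\<close> at \<open>(\<kappa>, \<kappa>')\<close>
        is 1 and its other coefficients at keys from \<open>n\<close> on are zero. Subtracting
        \<open>?c\<close> times \<open>?e\<close> thus clears the key \<open>n\<close> and creates
        nothing above it.\<close>
      have "P (\<lambda>\<sigma>. f \<sigma> - ?c * ?e \<sigma>)"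
      proof (rule Suc.IH)
        fix \<mu> \<mu>' assume b: "bounded_word N \<mu>" "bounded_word N \<mu>'" and n: "n \<le> word_key N \<mu> \<mu>'"
        show "word_transform N (\<lambda>\<sigma>. f \<sigma> - ?c * ?e \<sigma>) \<mu> \<mu>' = 0"
        proof (cases "\<forall>x\<in>{1..N}. \<mu> x = \<kappa> x \<and> \<mu>' x = \<kappa>' x")
          case True
          then have "word_transform N g \<mu> \<mu>' = word_transform N g \<kappa> \<kappa>'" for g
            by (intro word_transform_cong) auto
          then show ?thesis
            unfolding word_transform_diff_scale
            by (simp add: word_transform_block_alternator_leading[OF \<sigma>\<^sub>0(1) Q Q''])
        next
          case False
          then obtain x where x: "x \<in> {1..N}" "\<mu> x \<noteq> \<kappa> x \<or> \<mu>' x \<noteq> \<kappa>' x"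
            by blast
          have "word_key N \<kappa> \<kappa>' \<noteq> word_key N \<mu> \<mu>'"
            using word_key_inj[OF bd b _ x(1)] x(2) by metis
          then have "word_transform N f \<mu> \<mu>' = 0"
            using n key by (intro lead b) simp
          moreover have "word_transform N ?e \<mu> \<mu>' = 0"
          proof (rule ccontr)
            assume "word_transform N ?e \<mu> \<mu>' \<noteq> 0"
            from block_alternator_below[OF \<sigma>\<^sub>0(1) Q Q'' bd b n[folded key] this x(1)] x(2)
            show False
              by simp
          qed
          ultimately show ?thesis
            unfolding word_transform_diff_scale by simp
        qed
      qed
      with \<sigma>\<^sub>0(3) show ?thesis
        by (rule closed)
    qed
  qed
  moreover obtain n where "\<And>\<mu> \<mu>'. bounded_word N \<mu> \<Longrightarrow> bounded_word N \<mu>' \<Longrightarrow> word_key N \<mu> \<mu>' < n"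
  proof
    fix \<mu> \<mu>' assume b: "bounded_word N \<mu>" "bounded_word N \<mu>'"
    have less: "(N * N - (\<Sum>x\<in>{1..N}. \<mu> x)) * Suc N ^ Suc N + colex_number N \<mu> < Suc (N * N) * Suc N ^ Suc N + 0"
      using colex_number_bound[OF b(1)] by (intro lex_number_less) auto
    show "word_key N \<mu> \<mu>' < (Suc (N * N) * Suc N ^ Suc N + 0) * Suc N ^ Suc N + 0"
      unfolding word_key_def by (rule lex_number_less[OF less colex_number_bound[OF b(2)]])
  qed
  ultimately show ?thesis
    by (metis linorder_not_le)
qed

subsection \<open>Products of minors as signed sums\<close>

text \<open>The Leibniz formula over an arbitrary index set, so that permutations of different
  blocks compose without renumbering.\<close>

definition det_on :: "'a set \<Rightarrow> ('a \<Rightarrow> 'a \<Rightarrow> 'b::comm_ring_1) \<Rightarrow> 'b" where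
  "det_on I m = (\<Sum>\<tau> | \<tau> permutes I. of_int (sign \<tau>) * (\<Prod>x\<in>I. m x (\<tau> x)))"

lemma det_on_set_list:
  assumes "distinct b"
  shows "det_on (set b) m = det (mat (length b) (length b) (\<lambda>(r, s). m (b ! r) (b ! s)))"
proof -
  let ?k = "{0..<length b}"
  have bij: "bij_betw ((!) b) ?k (set b)"
    using assms by (intro bij_betw_nth) auto
  then have inj: "inj_on ((!) b) ?k"
    by (rule bij_betw_imp_inj_on)
  let ?i = "map_permutation ?k ((!) b)" and ?j = "map_permutation (set b) (inv_into ?k ((!) b))"
  have "det (mat (length b) (length b) (\<lambda>(r, s). m (b ! r) (b ! s)))
    = (\<Sum>p | p permutes ?k. of_int (sign p) * (\<Prod>r\<in>?k. m (b ! r) (b ! p r)))"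
  proof -
    have "p r < length b" if "p permutes ?k" "r < length b" for p r
      using permutes_in_image[OF that(1), of r] that(2) by simp
    then show ?thesis
      by (simp add: det_def)
  qed
  also have "\<dots> = det_on (set b) m"
    unfolding det_on_def
  proof (rule sum.reindex_bij_witness[where i = ?j and j = ?i])
    fix p assume "p \<in> {p. p permutes ?k}"
    then have p: "p permutes ?k" by simp
    show "?j (?i p) = p"
      using bij p inj by (intro map_permutation_compose_inv) auto
    show "?i p \<in> {p. p permutes set b}"
      using map_permutation_permutes[OF bij p] by simp
    have "(\<Prod>x\<in>set b. m x (?i p x)) = (\<Prod>r\<in>?k. m (b ! r) (?i p (b ! r)))"
      using prod.reindex_bij_betw[OF bij, of "\<lambda>x. m x (?i p x)"] by simp
    also have "\<dots> = (\<Prod>r\<in>?k. m (b ! r) (b ! p r))"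
      using map_permutation_apply[OF inj, of _ p] by (intro prod.cong) auto
    finally show "of_int (sign (?i p)) * (\<Prod>x\<in>set b. m x (?i p x)) =
        of_int (sign p) * (\<Prod>r\<in>?k. m (b ! r) (b ! p r))"
      using sign_map_permutation[OF inj p] by simp
  next
    fix p assume "p \<in> {p. p permutes set b}"
    then have p: "p permutes set b" by simp
    note bij' = bij_betw_inv_into[OF bij]
    show "?j p \<in> {p. p permutes ?k}"
      using map_permutation_permutes[OF bij' p] by simp
    show "?i (?j p) = p"
      by (rule map_permutation_compose_inv[OF bij' p]) (use bij in \<open>auto simp: bij_betw_inv_into_right\<close>)
  qed
  finally show ?thesis ..
qed

text \<open>A permutation preserving all blocks is uniquely a permutation of one block composed with
  one of the union of the others; signs and products multiply. The restrictions
  \<open>restrict_id\<close> recover the two factors.\<close>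

lemma sum_permutes_preserving:
  fixes m :: "'a \<Rightarrow> 'a \<Rightarrow> 'b::comm_ring_1"
  assumes "finite Q" "\<And>i. i \<in> Q \<Longrightarrow> finite (B i)"
    and "\<And>i j. i \<in> Q \<Longrightarrow> j \<in> Q \<Longrightarrow> i \<noteq> j \<Longrightarrow> B i \<inter> B j = {}"
  shows "(\<Sum>\<tau> | \<tau> permutes (\<Union>i\<in>Q. B i) \<and> (\<forall>i\<in>Q. \<tau> ` B i \<subseteq> B i).
      of_int (sign \<tau>) * (\<Prod>x\<in>(\<Union>i\<in>Q. B i). m x (\<tau> x))) = (\<Prod>i\<in>Q. det_on (B i) m)"
  using assms
proof (induction Q rule: finite_induct)
  case empty
  have "{\<tau>. \<tau> permutes ({} :: 'a set)} = {id}"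
    by auto
  then show ?case by simp
next
  case (insert i Q)
  define U where "U = (\<Union>i\<in>Q. B i)"
  define C where "C = B i"
  define S where "S = {\<tau>. \<tau> permutes U \<and> (\<forall>i\<in>Q. \<tau> ` B i \<subseteq> B i)}"
  define w where "w I \<tau> = of_int (sign \<tau>) * (\<Prod>x\<in>I. m x (\<tau> x))" for I \<tau>
  have fin: "finite U" "finite C"
    using insert.hyps(1) insert.prems(1) by (auto simp: U_def C_def)
  have disj: "C \<inter> U = {}"
    using insert.hyps(2) insert.prems(2)[of i] by (force simp: U_def C_def)
  have left: "(\<tau>\<^sub>1 \<circ> \<tau>\<^sub>2) x = \<tau>\<^sub>1 x" if "\<tau>\<^sub>2 permutes U" "x \<in> C" for \<tau>\<^sub>1 \<tau>\<^sub>2 x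
  proof -
    have "x \<notin> U"
      using that(2) disj by blast
    then show ?thesis
      using permutes_not_in[OF that(1)] by simp
  qed
  have right: "(\<tau>\<^sub>1 \<circ> \<tau>\<^sub>2) x = \<tau>\<^sub>2 x" if "\<tau>\<^sub>1 permutes C" "\<tau>\<^sub>2 permutes U" "x \<in> U" for \<tau>\<^sub>1 \<tau>\<^sub>2 x
    using that disj permutes_in_image[OF that(2), of x] permutes_not_in[OF that(1), of "\<tau>\<^sub>2 x"] by auto
  have restrict: "restrict_id \<tau> D permutes D" if "\<tau> permutes C \<union> U" "\<tau> ` D \<subseteq> D" "finite D" for \<tau> and D :: "'a set"
  proof (rule permutes_restrict_id)
    have "inj_on \<tau> D"
      by (rule permutes_inj_on[OF that(1)])
    then show "bij_betw \<tau> D D"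
      using that(2,3) by (simp add: bij_betw_def endo_inj_surj)
  qed
  have UN: "(\<Union>i\<in>insert i Q. B i) = C \<union> U"
    by (simp add: U_def C_def)
  have "(\<Sum>\<tau> | \<tau> permutes (\<Union>i\<in>insert i Q. B i) \<and> (\<forall>i\<in>insert i Q. \<tau> ` B i \<subseteq> B i). w (C \<union> U) \<tau>)
    = (\<Sum>(\<tau>\<^sub>1, \<tau>\<^sub>2)\<in>{\<tau>. \<tau> permutes C} \<times> S. w C \<tau>\<^sub>1 * w U \<tau>\<^sub>2)"
  proof (rule sum.reindex_bij_witness[where j = "\<lambda>\<tau>. (restrict_id \<tau> C, restrict_id \<tau> U)" and
        i = "\<lambda>(\<tau>\<^sub>1, \<tau>\<^sub>2). \<tau>\<^sub>1 \<circ> \<tau>\<^sub>2"])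
    fix \<tau> assume "\<tau> \<in> {\<tau>. \<tau> permutes (\<Union>i\<in>insert i Q. B i) \<and> (\<forall>i\<in>insert i Q. \<tau> ` B i \<subseteq> B i)}"
    then have \<tau>: "\<tau> permutes C \<union> U" "\<tau> ` C \<subseteq> C" "\<forall>i\<in>Q. \<tau> ` B i \<subseteq> B i"
      unfolding UN by (auto simp: C_def)
    then have \<tau>U: "\<tau> ` U \<subseteq> U"
      by (fastforce simp: U_def)
    have p1: "restrict_id \<tau> C permutes C" and p2: "restrict_id \<tau> U permutes U"
      using restrict[OF \<tau>(1)] \<tau>(2) \<tau>U fin by auto
    show comp: "(case (restrict_id \<tau> C, restrict_id \<tau> U) of (\<tau>\<^sub>1, \<tau>\<^sub>2) \<Rightarrow> \<tau>\<^sub>1 \<circ> \<tau>\<^sub>2) = \<tau>"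
    proof (simp, rule ext)
      fix x
      consider "x \<in> C" | "x \<in> U" | "x \<notin> C \<union> U"
        by blast
      then show "(restrict_id \<tau> C \<circ> restrict_id \<tau> U) x = \<tau> x"
      proof cases
        case 1
        then show ?thesis
          using left[OF p2 1, of "restrict_id \<tau> C"] 1 by (simp only: restrict_id_simps)
      next
        case 2
        then show ?thesis
          using right[OF p1 p2 2] 2 by (simp only: restrict_id_simps)
      next
        case 3
        then show ?thesis
          using permutes_not_in[OF \<tau>(1) 3] by simp
      qed
    qed
    have "restrict_id \<tau> U ` B j \<subseteq> B j" if "j \<in> Q" for j
    proof -
      have "B j \<subseteq> U"
        using that by (auto simp: U_def)
      then show ?thesis
        using \<tau>(3) that by (auto simp: restrict_id_def)
    qed
    then show "(restrict_id \<tau> C, restrict_id \<tau> U) \<in> {\<tau>. \<tau> permutes C} \<times> S"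
      using p1 p2 by (simp add: S_def)
    have "sign \<tau> = sign (restrict_id \<tau> C) * sign (restrict_id \<tau> U)"
    proof -
      have "permutation (restrict_id \<tau> C)" "permutation (restrict_id \<tau> U)"
        using p1 p2 fin permutation_permutes by blast+
      then show ?thesis
        using sign_compose comp by force
    qed
    moreover have "(\<Prod>x\<in>C \<union> U. m x (\<tau> x)) = (\<Prod>x\<in>C. m x (restrict_id \<tau> C x)) * (\<Prod>x\<in>U. m x (restrict_id \<tau> U x))"
      using fin disj by (subst prod.union_disjoint) auto
    ultimately show "(case (restrict_id \<tau> C, restrict_id \<tau> U) of (\<tau>\<^sub>1, \<tau>\<^sub>2) \<Rightarrow> w C \<tau>\<^sub>1 * w U \<tau>\<^sub>2) = w (C \<union> U) \<tau>"
      by (simp add: w_def)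
  next
    fix \<tau>s assume "\<tau>s \<in> {\<tau>. \<tau> permutes C} \<times> S"
    then obtain \<tau>\<^sub>1 \<tau>\<^sub>2 where \<tau>: "\<tau>s = (\<tau>\<^sub>1, \<tau>\<^sub>2)" "\<tau>\<^sub>1 permutes C" "\<tau>\<^sub>2 permutes U"
        "\<And>j. j \<in> Q \<Longrightarrow> \<tau>\<^sub>2 ` B j \<subseteq> B j"
      by (auto simp: S_def)
    have "restrict_id (\<tau>\<^sub>1 \<circ> \<tau>\<^sub>2) C = \<tau>\<^sub>1"
      using left[OF \<tau>(3)] permutes_not_in[OF \<tau>(2)] by (auto simp: restrict_id_def fun_eq_iff)
    moreover have "restrict_id (\<tau>\<^sub>1 \<circ> \<tau>\<^sub>2) U = \<tau>\<^sub>2"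
      using right[OF \<tau>(2,3)] permutes_not_in[OF \<tau>(3)] by (auto simp: restrict_id_def fun_eq_iff)
    ultimately show "(restrict_id (case \<tau>s of (\<tau>\<^sub>1, \<tau>\<^sub>2) \<Rightarrow> \<tau>\<^sub>1 \<circ> \<tau>\<^sub>2) C,
        restrict_id (case \<tau>s of (\<tau>\<^sub>1, \<tau>\<^sub>2) \<Rightarrow> \<tau>\<^sub>1 \<circ> \<tau>\<^sub>2) U) = \<tau>s"
      using \<tau>(1) by simp
    have "\<tau>\<^sub>1 \<circ> \<tau>\<^sub>2 permutes C \<union> U"
      using \<tau>(2,3) by (intro permutes_compose) (auto intro: permutes_subset)
    moreover have "(\<tau>\<^sub>1 \<circ> \<tau>\<^sub>2) ` C \<subseteq> C"
      by (intro image_subsetI) (simp only: left[OF \<tau>(3)] permutes_in_image[OF \<tau>(2)])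
    moreover have "(\<tau>\<^sub>1 \<circ> \<tau>\<^sub>2) ` B j \<subseteq> B j" if "j \<in> Q" for j
    proof -
      have "B j \<subseteq> U"
        using that by (auto simp: U_def)
      then show ?thesis
        using \<tau>(4)[OF that] by (intro image_subsetI, subst right[OF \<tau>(2,3)]) auto
    qed
    ultimately show "(case \<tau>s of (\<tau>\<^sub>1, \<tau>\<^sub>2) \<Rightarrow> \<tau>\<^sub>1 \<circ> \<tau>\<^sub>2)
        \<in> {\<tau>. \<tau> permutes (\<Union>i\<in>insert i Q. B i) \<and> (\<forall>i\<in>insert i Q. \<tau> ` B i \<subseteq> B i)}"
      unfolding UN using \<tau>(1) by (simp add: C_def)
  qed
  also have "\<dots> = det_on C m * (\<Sum>\<tau>\<in>S. w U \<tau>)"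
    unfolding det_on_def w_def sum_product sum.cartesian_product ..
  also have "(\<Sum>\<tau>\<in>S. w U \<tau>) = (\<Prod>i\<in>Q. det_on (B i) m)"
    unfolding S_def w_def U_def using insert.prems by (intro insert.IH) auto
  finally show ?case
    using insert.hyps by (simp add: w_def C_def U_def)
qed

section \<open>Specialization of rows and columns\<close>

definition word_monomial :: "nat \<Rightarrow> (nat \<Rightarrow> nat) \<Rightarrow> (nat \<Rightarrow> nat) \<Rightarrow> matpoly" where
  "word_monomial N v w = (\<Prod>x\<in>{1..N}. X (v x) (w x))"

text \<open>Row \<open>x\<close> of the multilinear polynomial becomes row \<open>v x\<close> and
  column \<open>y\<close> becomes column \<open>w y\<close>. The map is linear in \<open>f\<close>,
  but in general not injective.\<close>

definition perm_poly :: "nat \<Rightarrow> (nat \<Rightarrow> nat) \<Rightarrow> (nat \<Rightarrow> nat) \<Rightarrow> ((nat \<Rightarrow> nat) \<Rightarrow> complex) \<Rightarrow> matpoly" where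
  "perm_poly N v w f = (\<Sum>\<sigma> | \<sigma> permutes {1..N}. matpoly_scale (f \<sigma>) (word_monomial N v (w \<circ> \<sigma>)))"

lemma perm_poly_diff_scale:
  "perm_poly N v w (\<lambda>\<sigma>. f \<sigma> - c * g \<sigma>) = perm_poly N v w f - matpoly_scale c (perm_poly N v w g)"
  unfolding perm_poly_def matpoly.scale_sum_right sum_subtractf[symmetric]
  by (intro sum.cong refl) (simp add: matpoly.scale_left_diff_distrib)

lemma matpoly_scale_of_int: "matpoly_scale (of_int z) p = of_int z * p"
proof -
  have "matpoly_scale (of_nat n) p = of_nat n * p" for n
    by (induction n) (simp_all add: matpoly.scale_left_distrib distrib_right)
  then show ?thesis
    by (cases z rule: int_diff_cases) (simp add: matpoly.scale_left_diff_distrib left_diff_distrib)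
qed

lemma perm_poly_block_alternator:
  assumes \<sigma>\<^sub>0: "\<sigma>\<^sub>0 permutes {1..N}" and Q: "noncrossing_matching N \<rho> Q"
  shows "perm_poly N v w (block_alternator Q \<sigma>\<^sub>0) =
    (\<Prod>b\<in>Q. det (mat (length b) (length b) (\<lambda>(r, s). X (v (b ! r)) (w (\<sigma>\<^sub>0 (b ! s))))))"
proof -
  note D = noncrossing_matchingD[OF Q]
  let ?m = "\<lambda>x y. X (v x) (w (\<sigma>\<^sub>0 y))"
  have "perm_poly N v w (block_alternator Q \<sigma>\<^sub>0) = (\<Sum>\<tau> | \<tau> permutes {1..N}.
      if preserves Q \<tau> then of_int (sign \<tau>) * (\<Prod>x\<in>{1..N}. ?m x (\<tau> x)) else 0)"
    unfolding perm_poly_def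
    by (subst sum_permutes_shift[OF \<sigma>\<^sub>0], intro sum.cong refl)
      (simp add: block_alternator_shift[OF \<sigma>\<^sub>0] matpoly_scale_of_int word_monomial_def)
  also have "\<dots> = (\<Sum>\<tau> | \<tau> permutes {1..N} \<and> preserves Q \<tau>. of_int (sign \<tau>) * (\<Prod>x\<in>{1..N}. ?m x (\<tau> x)))"
    by (subst sum.inter_filter[symmetric]) (simp_all add: finite_permutations)
  also have "\<dots> = (\<Prod>b\<in>Q. det_on (set b) ?m)"
    using sum_permutes_preserving[of Q set ?m] D(1,5) unfolding D(7) preserves_def by simp
  also have "\<dots> = (\<Prod>b\<in>Q. det (mat (length b) (length b) (\<lambda>(r, s). X (v (b ! r)) (w (\<sigma>\<^sub>0 (b ! s))))))"
    using D(3) by (intro prod.cong refl det_on_set_list) (auto simp: strict_sorted_iff)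
  finally show ?thesis .
qed

text \<open>This disposes of the matchings in which a block holds two positions of the same
  segment.\<close>

lemma det_eq_zero_of_not_distinct:
  assumes "length b = length c" "\<not> distinct b \<or> \<not> distinct c"
  shows "det (mat (length b) (length b) (\<lambda>(r, s). X (b ! r) (c ! s))) = 0"
  using assms(2)
proof
  assume "\<not> distinct b"
  then obtain i j where ij: "i < length b" "j < length b" "i \<noteq> j" "b ! i = b ! j"
    by (auto simp: distinct_conv_nth)
  then show ?thesis
    by (intro det_identical_rows[of _ "length b" i j]) (auto intro: eq_vecI)
next
  assume "\<not> distinct c"
  then obtain i j where ij: "i < length b" "j < length b" "i \<noteq> j" "c ! i = c ! j"
    using assms(1) by (auto simp: distinct_conv_nth)
  then show ?thesis
    by (intro det_identical_columns[of _ "length b" i j]) (auto intro: eq_vecI)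
qed

lemma minor_strict:
  assumes "sorted_wrt (<) b" "sorted_wrt (<) c" "length b = length c"
  shows "minor (set b) (set c) = det (mat (length b) (length b) (\<lambda>(r, s). X (b ! r) (c ! s)))"
  using assms by (simp add: minor_def card_set_strict sorted_list_of_set_strict)

subsection \<open>Segments\<close>

definition cumulative_count :: "nat multiset \<Rightarrow> nat \<Rightarrow> nat" where
  "cumulative_count \<alpha> u = (\<Sum>w\<le>u. count \<alpha> w)"

text \<open>Undoes standardization: for \<open>x\<close> in \<open>{1..size \<alpha>}\<close> this
  is the value whose segment contains \<open>x\<close>. Beyond \<open>size \<alpha>\<close> the
  \<open>LEAST\<close> has no witness.\<close>

definition position_value :: "nat multiset \<Rightarrow> nat \<Rightarrow> nat" where
  "position_value \<alpha> x = (LEAST u. x \<le> cumulative_count \<alpha> u)"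

lemma cumulative_count_mono: "u \<le> u' \<Longrightarrow> cumulative_count \<alpha> u \<le> cumulative_count \<alpha> u'"
  unfolding cumulative_count_def by (rule sum_mono2) auto

lemma cumulative_count_eq_size:
  assumes "set_mset \<alpha> \<subseteq> {..n}"
  shows "cumulative_count \<alpha> n = size \<alpha>"
  unfolding cumulative_count_def size_multiset_overloaded_eq using assms
  by (intro sum.mono_neutral_right) (auto simp: not_in_iff)

lemma cumulative_count_le_size: "cumulative_count \<alpha> u \<le> size \<alpha>"
proof -
  obtain n where "set_mset \<alpha> \<subseteq> {..n}"
    using finite_nat_iff_bounded_le[of "set_mset \<alpha>"] by auto
  then have "set_mset \<alpha> \<subseteq> {..max n u}"
    by auto
  from cumulative_count_eq_size[OF this] cumulative_count_mono[of u "max n u" \<alpha>] show ?thesis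
    by simp
qed

lemma position_value_le_iff:
  assumes "x \<in> {1..size \<alpha>}"
  shows "position_value \<alpha> x \<le> u \<longleftrightarrow> x \<le> cumulative_count \<alpha> u"
proof
  obtain n where "set_mset \<alpha> \<subseteq> {..n}"
    using finite_nat_iff_bounded_le[of "set_mset \<alpha>"] by auto
  then have "x \<le> cumulative_count \<alpha> n"
    using assms by (simp add: cumulative_count_eq_size)
  then have "x \<le> cumulative_count \<alpha> (position_value \<alpha> x)"
    unfolding position_value_def by (rule LeastI)
  then show "x \<le> cumulative_count \<alpha> u" if "position_value \<alpha> x \<le> u"
    using cumulative_count_mono[OF that, of \<alpha>] by simp
next
  assume "x \<le> cumulative_count \<alpha> u"
  then show "position_value \<alpha> x \<le> u"
    unfolding position_value_def by (rule Least_le)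
qed

lemma position_value_mono:
  assumes "x \<in> {1..size \<alpha>}" "y \<in> {1..size \<alpha>}" "x \<le> y"
  shows "position_value \<alpha> x \<le> position_value \<alpha> y"
  using assms position_value_le_iff[of x \<alpha> "position_value \<alpha> y"]
    position_value_le_iff[of y \<alpha> "position_value \<alpha> y"] by simp

lemma segment_subset: "segment \<alpha> u \<subseteq> {1..size \<alpha>}"
  using cumulative_count_le_size[of \<alpha> u] by (auto simp: segment_def cumulative_count_def)

lemma mem_segment_iff:
  assumes "x \<in> {1..size \<alpha>}"
  shows "x \<in> segment \<alpha> u \<longleftrightarrow> position_value \<alpha> x = u"
proof -
  have "x \<in> segment \<alpha> u \<longleftrightarrow> \<not> x \<le> (\<Sum>w<u. count \<alpha> w) \<and> position_value \<alpha> x \<le> u"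
    using position_value_le_iff[OF assms, of u] by (auto simp: segment_def cumulative_count_def)
  also have "x \<le> (\<Sum>w<u. count \<alpha> w) \<longleftrightarrow> position_value \<alpha> x < u"
  proof (cases u)
    case 0
    then show ?thesis using assms by simp
  next
    case (Suc u')
    then show ?thesis
      using position_value_le_iff[OF assms, of u']
      by (simp add: cumulative_count_def lessThan_Suc_atMost less_Suc_eq_le)
  qed
  finally show ?thesis by auto
qed

lemma image_mset_position_value: "image_mset (position_value \<alpha>) (mset_set {1..size \<alpha>}) = \<alpha>"
proof (rule multiset_eqI)
  fix u
  have "position_value \<alpha> -` {u} \<inter> {1..size \<alpha>} = segment \<alpha> u"
    using segment_subset[of \<alpha> u] mem_segment_iff[of _ \<alpha> u] by blast
  then have "count (image_mset (position_value \<alpha>) (mset_set {1..size \<alpha>})) u = card (segment \<alpha> u)"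
    using segment_subset[of \<alpha> u] by (simp add: count_image_mset subset_iff)
  also have "card (segment \<alpha> u) = count \<alpha> u"
    by (simp add: segment_def flip: lessThan_Suc_atMost)
  finally show "count (image_mset (position_value \<alpha>) (mset_set {1..size \<alpha>})) u = count \<alpha> u" .
qed

lemma position_value_in: "x \<in> {1..size \<alpha>} \<Longrightarrow> position_value \<alpha> x \<in># \<alpha>"
  by (subst (2) image_mset_position_value[symmetric]) simp

subsection \<open>Order of the columns\<close>

text \<open>Ordering columns by this key puts longer columns first and arranges columns of equal
  length as condition (ii) of non-crossing fillings demands.\<close>

definition column_key :: "nat \<Rightarrow> nat \<Rightarrow> nat list \<Rightarrow> nat" where
  "column_key B M c = (M - length c) * B ^ M + (\<Sum>s<length c. c ! s * B ^ s)"

lemma column_key_le: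
  assumes le: "column_key B M c \<le> column_key B M d"
    and c: "length c \<le> M" "\<And>i. i \<in> set c \<Longrightarrow> i < B" and d: "length d \<le> M" "\<And>i. i \<in> set d \<Longrightarrow> i < B"
  shows "length d \<le> length c"
    and "length c = length d \<Longrightarrow> s < length d \<Longrightarrow> c ! s \<noteq> d ! s \<Longrightarrow>
      (\<And>t. t < length d \<Longrightarrow> s < t \<Longrightarrow> c ! t = d ! t) \<Longrightarrow> c ! s < d ! s"
proof -
  show "length d \<le> length c"
  proof (rule ccontr)
    assume less: "\<not> length d \<le> length c"
    then have "0 < B"
      using d(2)[of "d ! 0"] by (metis gr0I le0 length_0_conv less_zeroE list.size(3) nth_mem)
    have "(\<Sum>s<length d. d ! s * B ^ s) < B ^ length d"
      using d(2) by (intro digit_sum_less) simp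
    also have "\<dots> \<le> B ^ M"
      using \<open>0 < B\<close> d(1) by (intro power_increasing) auto
    finally have "column_key B M d < column_key B M c"
      unfolding column_key_def using less d(1) by (intro lex_number_less) auto
    with le show False by simp
  qed
  assume len: "length c = length d" and s: "s < length d" "c ! s \<noteq> d ! s"
    and later: "\<And>t. t < length d \<Longrightarrow> s < t \<Longrightarrow> c ! t = d ! t"
  show "c ! s < d ! s"
  proof (rule ccontr)
    assume "\<not> c ! s < d ! s"
    then have "d ! s < c ! s"
      using s(2) by simp
    then have "(\<Sum>s<length d. d ! s * B ^ s) < (\<Sum>s<length d. c ! s * B ^ s)"
      using s(1) later[symmetric] d(2) by (intro colex_digit_sum_less[where x = s]) auto
    then show False
      using le len by (simp add: column_key_def)
  qed
qed

lemma sorted_columns: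
  assumes sorted: "sorted (map (column_key B M) T)"
    and T: "\<And>c. c \<in> set T \<Longrightarrow> length c \<le> M" "\<And>c i. c \<in> set T \<Longrightarrow> i \<in> set c \<Longrightarrow> i < B"
  shows "sorted_wrt (\<ge>) (map length T)" and "equal_columns_arranged T"
proof -
  have le: "column_key B M (T ! k) \<le> column_key B M (T ! l)" if "k < l" "l < length T" for k l
    using sorted that by (auto simp: sorted_iff_nth_mono)
  note key = column_key_le[OF le]
  show "sorted_wrt (\<ge>) (map length T)"
    unfolding sorted_wrt_map
    unfolding sorted_wrt_iff_nth_less
  proof (intro allI impI)
    fix k l assume kl: "k < l" "l < length T"
    then have "T ! k \<in> set T" "T ! l \<in> set T"
      by auto
    note in_T = this
    show "length (T ! l) \<le> length (T ! k)"
      by (rule key(1)[OF kl T(1)[OF in_T(1)] T(2)[OF in_T(1)] T(1)[OF in_T(2)] T(2)[OF in_T(2)]])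
  qed
  show "equal_columns_arranged T"
    unfolding equal_columns_arranged_def Let_def
  proof (intro allI impI)
    fix k l
    assume kl: "k < l \<and> l < length T \<and> length (T ! k) = length (T ! l) \<and> T ! k \<noteq> T ! l"
    define s where "s = Max {s. s < length (T ! k) \<and> T ! k ! s \<noteq> T ! l ! s}"
    have "\<exists>s\<in>{..<length (T ! k)}. T ! k ! s \<noteq> T ! l ! s"
      using kl by (auto simp: list_eq_iff_nth_eq)
    then have ne: "{s. s < length (T ! k) \<and> T ! k ! s \<noteq> T ! l ! s} \<noteq> {}"
      by auto
    have s: "s < length (T ! k)" "T ! k ! s \<noteq> T ! l ! s"
      using Max_in[OF _ ne] by (auto simp: s_def)
    have later: "T ! k ! t = T ! l ! t" if "t < length (T ! k)" "s < t" for t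
    proof (rule ccontr)
      assume "T ! k ! t \<noteq> T ! l ! t"
      with that(1) have "t \<le> s"
        unfolding s_def by (intro Max_ge) auto
      with that(2) show False by simp
    qed
    have in_T: "T ! k \<in> set T" "T ! l \<in> set T"
      using kl by auto
    show "T ! k ! Max {s. s < length (T ! k) \<and> T ! k ! s \<noteq> T ! l ! s} <
        T ! l ! Max {s. s < length (T ! k) \<and> T ! k ! s \<noteq> T ! l ! s}"
      unfolding s_def[symmetric]
      by (rule key(2)[OF _ _ T(1)[OF in_T(1)] T(2)[OF in_T(1)] T(1)[OF in_T(2)] T(2)[OF in_T(2)]])
        (use kl s later in auto)
  qed
qed

lemma descending_lists_eq:
  fixes xs ys :: "nat list"
  assumes "sorted_wrt (\<ge>) xs" "sorted_wrt (\<ge>) ys" "mset xs = mset ys"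
  shows "xs = ys"
proof -
  have "sorted (rev xs)" "sorted (rev ys)" "mset (rev xs) = mset (rev ys)"
    using assms by (simp_all add: sorted_wrt_rev)
  then have "rev xs = rev ys"
    by (metis properties_for_sort)
  then show ?thesis by simp
qed

subsection \<open>Spanning by non-crossing bitableaux\<close>

definition matching_filling :: "nat multiset \<Rightarrow> nat list list \<Rightarrow> nat list list" where
  "matching_filling \<alpha> Is = map (map (position_value \<alpha>)) Is"

lemma matching_concat:
  assumes "noncrossing_matching N \<rho> (set Is)" "distinct Is"
  shows "distinct (concat Is)" "set (concat Is) = {1..N}"
proof -
  note D = noncrossing_matchingD[OF assms(1)]
  show "distinct (concat Is)"
    using assms(2) D(3,5) by (intro distinct_concat) (auto simp: strict_sorted_iff)
  show "set (concat Is) = {1..N}"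
    using D(7) by simp
qed

lemma matching_sorted_order:
  assumes "noncrossing_matching (size \<alpha>) \<rho> Q" "set_mset \<alpha> \<subseteq> {1..n}"
  obtains Is where "set Is = Q" "distinct Is"
    "sorted_wrt (\<ge>) (map length Is)" "equal_columns_arranged (matching_filling \<alpha> Is)"
proof -
  note D = noncrossing_matchingD[OF assms(1)]
  obtain xs where xs: "set xs = Q" "distinct xs"
    using finite_distinct_list[OF D(1)] by blast
  \<comment> \<open>The values are at most \<open>n\<close>, hence digits in base
    \<open>Suc n\<close>, and a block has at most \<open>size \<alpha>\<close> entries.\<close>
  let ?key = "\<lambda>b. column_key (Suc n) (size \<alpha>) (map (position_value \<alpha>) b)"
  define Is where "Is = sort_key ?key xs"
  have Is: "set Is = Q" "distinct Is"
    using xs by (auto simp: Is_def)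
  have range: "set b \<subseteq> {1..size \<alpha>}" if "b \<in> Q" for b
    using D(7) that by blast
  have "sorted (map (column_key (Suc n) (size \<alpha>)) (matching_filling \<alpha> Is))"
    using sorted_sort_key[of ?key xs] by (simp add: matching_filling_def Is_def o_def)
  moreover have "length c \<le> size \<alpha>" if "c \<in> set (matching_filling \<alpha> Is)" for c
  proof -
    from that Is obtain b where b: "b \<in> Q" "c = map (position_value \<alpha>) b"
      by (auto simp: matching_filling_def)
    have "card (set b) \<le> card {1..size \<alpha>}"
      using range[OF b(1)] by (intro card_mono) auto
    then show ?thesis
      using b(2) card_set_strict[OF D(3)[OF b(1)]] by simp
  qed
  moreover have "i < Suc n" if c: "c \<in> set (matching_filling \<alpha> Is)" "i \<in> set c" for c i
  proof -
    from c Is obtain b x where b: "b \<in> Q" "x \<in> set b" "i = position_value \<alpha> x"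
      by (auto simp: matching_filling_def)
    then have "i \<in># \<alpha>"
      using range position_value_in by blast
    then show ?thesis
      using assms(2) by auto
  qed
  ultimately have "sorted_wrt (\<ge>) (map length (matching_filling \<alpha> Is))"
    "equal_columns_arranged (matching_filling \<alpha> Is)"
    using sorted_columns by blast+
  then show thesis
    using that Is by (simp add: matching_filling_def o_def)
qed

text \<open>Injectivity of \<open>position_value\<close> on the blocks does double duty: it makes
  the weakly increasing columns strict, and it says that a block meets each segment at most
  once.\<close>

lemma noncrossing_filling_of_matching:
  assumes Q: "noncrossing_matching (size \<alpha>) \<rho> (set Is)" and Is: "distinct Is"
    and bd: "bounded_word (size \<alpha>) \<rho>" and rows: "row_counts (size \<alpha>) (word_count (size \<alpha>) \<rho>)"
    and \<alpha>: "set_mset \<alpha> \<subseteq> {1..n}"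
    and len: "map length Is = column_lengths (row_counts.shape (size \<alpha>) (word_count (size \<alpha>) \<rho>))"
    and arranged: "equal_columns_arranged (matching_filling \<alpha> Is)"
    and inj: "\<And>b. b \<in> set Is \<Longrightarrow> inj_on (position_value \<alpha>) (set b)"
  defines "T \<equiv> matching_filling \<alpha> Is"
  shows "column_strict_filling (row_counts.shape (size \<alpha>) (word_count (size \<alpha>) \<rho>)) T"
    and "filling_content T = \<alpha>"
    and "noncrossing_filling (row_counts.shape (size \<alpha>) (word_count (size \<alpha>) \<rho>)) T"
    and "\<And>c. c \<in> set T \<Longrightarrow> set c \<subseteq> {1..n}"
    and "\<And>b. b \<in> set Is \<Longrightarrow> sorted_wrt (<) (map (position_value \<alpha>) b)"
proof -
  let ?v = "position_value \<alpha>" and ?N = "size \<alpha>"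
  note D = noncrossing_matchingD[OF Q]
  have range: "x \<in> {1..?N}" if "b \<in> set Is" "x \<in> set b" for b x
    using D(7) that by blast
  show strict: "sorted_wrt (<) (map ?v b)" if b: "b \<in> set Is" for b
    unfolding sorted_wrt_map
  proof (rule sorted_wrt_mono_rel[OF _ D(3)[OF b]])
    fix x y assume xy: "x \<in> set b" "y \<in> set b" "x < y"
    then have "?v x \<le> ?v y"
      using range[OF b] by (intro position_value_mono) auto
    moreover have "?v x \<noteq> ?v y"
      using inj[OF b] xy by (auto dest: inj_onD)
    ultimately show "?v x < ?v y" by simp
  qed
  have "map length T = map length Is"
    by (simp add: T_def matching_filling_def o_def)
  then show "column_strict_filling (row_counts.shape ?N (word_count ?N \<rho>)) T"
    using strict len by (auto simp: column_strict_filling_def T_def matching_filling_def)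
  note conc = matching_concat[OF Q Is]
  have "filling_content T = image_mset ?v (mset (concat Is))"
    unfolding filling_content_def T_def matching_filling_def mset_concat[symmetric]
    by (simp only: map_concat[symmetric] mset_map)
  also have "mset (concat Is) = mset_set {1..?N}"
    using conc by (metis mset_set_set)
  finally show content: "filling_content T = \<alpha>"
    by (simp only: image_mset_position_value)
  show "set c \<subseteq> {1..n}" if "c \<in> set T" for c
  proof -
    from that obtain b where b: "b \<in> set Is" "c = map ?v b"
      by (auto simp: T_def matching_filling_def)
    then have "set c \<subseteq> set_mset \<alpha>"
      using range position_value_in by auto
    then show ?thesis
      using \<alpha> by blast
  qed
  \<comment> \<open>The blocks of the matching are the multiplicity-free tableau required by
    condition (i).\<close>
  have "standardizes_to T (set ` set Is)"
    unfolding standardizes_to_def Let_def content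
  proof (intro conjI ballI allI)
    fix S u assume "S \<in> set ` set Is"
    then obtain b where b: "b \<in> set Is" "S = set b"
      by auto
    have "x = y" if "x \<in> S \<inter> segment \<alpha> u" "y \<in> S \<inter> segment \<alpha> u" for x y
    proof -
      have xy: "x \<in> set b" "y \<in> set b"
        using that b by auto
      then have "?v x = u" "?v y = u"
        using that mem_segment_iff[OF range[OF b(1)]] by auto
      then show ?thesis
        using inj[OF b(1)] xy by (auto dest: inj_onD)
    qed
    then have "card (S \<inter> segment \<alpha> u) \<le> Suc 0"
      using b(2) by (subst card_le_Suc0_iff_eq) auto
    then show "card (S \<inter> segment \<alpha> u) \<le> 1"
      by simp
  next
    have "mset_set (set ` set Is) = image_mset set (mset_set (set Is))"
      using D(3) by (intro image_mset_mset_set[symmetric] inj_on_set_strict)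
    also have "mset_set (set Is) = mset Is"
      using Is by (rule mset_set_set)
    finally have "mset_set (set ` set Is) = image_mset set (mset Is)" .
    moreover have "{u. set b \<inter> segment \<alpha> u \<noteq> {}} = set (map ?v b)" if "b \<in> set Is" for b
      using mem_segment_iff[OF range[OF that]] by auto
    ultimately show "image_mset (\<lambda>S. {u. S \<inter> segment \<alpha> u \<noteq> {}}) (mset_set (set ` set Is)) =
        image_mset set (mset T)"
      by (auto simp: T_def matching_filling_def multiset.map_comp intro!: image_mset_cong)
  qed
  moreover have "multfree_noncrossing_tableau (row_counts.shape ?N (word_count ?N \<rho>)) (set ` set Is)"
    using bd by (intro noncrossing_matching_tableau(1)[OF Q _ rows]) (simp add: bounded_word_def)
  ultimately show "noncrossing_filling (row_counts.shape ?N (word_count ?N \<rho>)) T"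
    unfolding noncrossing_filling_def using arranged by (auto simp: T_def)
qed

lemma permutes_mapping_lists:
  assumes "distinct xs" "distinct ys" "set xs = A" "set ys = A"
  obtains \<sigma> where "\<sigma> permutes A" "map \<sigma> xs = ys"
proof -
  define \<sigma> where "\<sigma> x = (if x \<in> A then the (map_of (zip xs ys) x) else x)" for x
  have len: "length xs = length ys"
    using assms by (metis distinct_card)
  have map: "map \<sigma> xs = ys"
  proof (rule nth_equalityI)
    fix i assume "i < length (map \<sigma> xs)"
    then show "map \<sigma> xs ! i = ys ! i"
      using map_of_zip_nth[OF len assms(1), of i] len assms(3) by (auto simp: \<sigma>_def)
  qed (simp add: len)
  have "\<sigma> ` A = A"
    using map assms(3,4) by (metis set_map)
  moreover have "finite A"
    using assms(3) by auto
  ultimately have "bij_betw \<sigma> A A"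
    by (simp add: bij_betw_def eq_card_imp_inj_on)
  then have "\<sigma> permutes A"
    by (rule bij_imp_permutes) (simp add: \<sigma>_def)
  with map that show thesis by blast
qed

lemma perm_poly_in_noncrossing_span:
  assumes \<alpha>: "set_mset \<alpha> \<subseteq> {1..n}" and \<beta>: "set_mset \<beta> \<subseteq> {1..n}" and size: "size \<alpha> = size \<beta>"
  shows "perm_poly (size \<alpha>) (position_value \<alpha>) (position_value \<beta>) f \<in>
    matpoly.span {bitableau_monomial TT | lam TT.
      noncrossing_bitableau n lam TT \<and> bitableau_content TT = (\<alpha>, \<beta>)}"
    (is "?P f \<in> matpoly.span ?G")
proof -
  let ?N = "size \<alpha>" and ?v = "position_value \<alpha>" and ?w = "position_value \<beta>"
  show ?thesis
  proof (rule leading_pair_induction[where P = "\<lambda>f. ?P f \<in> matpoly.span ?G" and N = ?N])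
    fix f :: "(nat \<Rightarrow> nat) \<Rightarrow> complex" assume "\<And>\<sigma>. \<sigma> permutes {1..?N} \<Longrightarrow> f \<sigma> = 0"
    then have "?P f = 0"
      unfolding perm_poly_def by (intro sum.neutral) simp
    then show "?P f \<in> matpoly.span ?G"
      by (simp add: matpoly.span_zero)
  next
    fix f g c assume g: "?P g \<in> matpoly.span ?G" and fg: "?P (\<lambda>\<sigma>. f \<sigma> - c * g \<sigma>) \<in> matpoly.span ?G"
    have "?P f = ?P (\<lambda>\<sigma>. f \<sigma> - c * g \<sigma>) + matpoly_scale c (?P g)"
      by (simp add: perm_poly_diff_scale)
    then show "?P f \<in> matpoly.span ?G"
      using matpoly.span_add[OF fg matpoly.span_scale[OF g]] by simp
  next
    fix \<rho> \<rho>' Q Q'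
    assume bd: "bounded_word ?N \<rho>" "bounded_word ?N \<rho>'"
      and Q: "noncrossing_matching ?N \<rho> Q" and Q': "noncrossing_matching ?N \<rho>' Q'"
      and rows: "row_counts ?N (word_count ?N \<rho>)" and wc: "word_count ?N \<rho> = word_count ?N \<rho>'"
    let ?lam = "row_counts.shape ?N (word_count ?N \<rho>)"
    note rows' = rows[unfolded wc]
    obtain Is where Is: "set Is = Q" "distinct Is" "sorted_wrt (\<ge>) (map length Is)"
        "equal_columns_arranged (matching_filling \<alpha> Is)"
      using matching_sorted_order[OF Q \<alpha>] by blast
    obtain Js where Js: "set Js = Q'" "distinct Js" "sorted_wrt (\<ge>) (map length Js)"
        "equal_columns_arranged (matching_filling \<beta> Js)"
      using matching_sorted_order[OF Q'[unfolded size] \<beta>] by blast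
    have lens: "map length Is = column_lengths ?lam" "map length Js = column_lengths ?lam"
    proof -
      have "mset_set Q = mset Is" "mset_set Q' = mset Js"
        using Is Js by (metis mset_set_set)+
      then have "mset (map length Is) = mset (column_lengths ?lam)" "mset (map length Js) = mset (column_lengths ?lam)"
        using noncrossing_matching_tableau(2)[OF Q _ rows] noncrossing_matching_tableau(2)[OF Q' _ rows'] bd
        unfolding wc by (simp_all add: bounded_word_def)
      then show "map length Is = column_lengths ?lam" "map length Js = column_lengths ?lam"
        using Is(3) Js(3) row_counts.column_lengths_shape_sorted[OF rows] by (blast intro: descending_lists_eq)+
    qed
    \<comment> \<open>Both column orders are already fixed, so \<open>\<sigma>\<^sub>0\<close> is
      defined to carry the blocks of \<open>Is\<close> to those of \<open>Js\<close> place by place.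
      Equal column lengths then split the equation of the concatenations into blocks.\<close>
    obtain \<sigma>\<^sub>0 where \<sigma>\<^sub>0: "\<sigma>\<^sub>0 permutes {1..?N}" and conc: "map \<sigma>\<^sub>0 (concat Is) = concat Js"
      using permutes_mapping_lists matching_concat[of ?N \<rho> Is] matching_concat[of ?N \<rho>' Js] Q Q' Is(1,2) Js(1,2)
      by metis
    have map: "map (map \<sigma>\<^sub>0) Is = Js"
    proof (rule concat_injective)
      show "concat (map (map \<sigma>\<^sub>0) Is) = concat Js"
        using conc by (simp add: map_concat)
      have same: "map length Is = map length Js"
        using lens by simp
      then show "length (map (map \<sigma>\<^sub>0) Is) = length Js"
        by (metis length_map)
      have "length (Is ! i) = length (Js ! i)" if "i < length Is" for i
        using same that by (metis length_map nth_map)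
      then show "\<forall>(x, y)\<in>set (zip (map (map \<sigma>\<^sub>0) Is) Js). length x = length y"
        by (auto simp: set_zip)
    qed
    then have Q'_eq: "Q' = map \<sigma>\<^sub>0 ` Q"
      using Is(1) Js(1) by auto
    let ?minor = "\<lambda>b. det (mat (length b) (length b) (\<lambda>(r, s). X (?v (b ! r)) (?w (\<sigma>\<^sub>0 (b ! s)))))"
    let ?minor' = "\<lambda>b. det (mat (length (map ?v b)) (length (map ?v b))
        (\<lambda>(r, s). X (map ?v b ! r) (map ?w (map \<sigma>\<^sub>0 b) ! s)))"
    have minor_eq: "?minor b = ?minor' b" for b
      by (intro arg_cong[where f = det]) (auto intro!: eq_matI)
    have poly: "?P (block_alternator Q \<sigma>\<^sub>0) = (\<Prod>b\<in>Q. ?minor b)"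
      by (rule perm_poly_block_alternator[OF \<sigma>\<^sub>0 Q])
    \<comment> \<open>A repeated row or column index in some block makes its determinant, and so the
      whole product, zero. Otherwise each determinant is the minor of the corresponding pair of
      columns.\<close>
    have "?P (block_alternator Q \<sigma>\<^sub>0) \<in> matpoly.span ?G"
    proof (cases "\<forall>b\<in>Q. distinct (map ?v b) \<and> distinct (map ?w (map \<sigma>\<^sub>0 b))")
      case False
      then obtain b where b: "b \<in> Q" "\<not> distinct (map ?v b) \<or> \<not> distinct (map ?w (map \<sigma>\<^sub>0 b))"
        by blast
      have "?minor b = 0"
        unfolding minor_eq using b(2) by (intro det_eq_zero_of_not_distinct) simp_all
      then have "(\<Prod>b\<in>Q. ?minor b) = 0"
        using b(1) noncrossing_matchingD(1)[OF Q] by (intro prod_zero) auto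
      then show ?thesis
        unfolding poly by (simp add: matpoly.span_zero)
    next
      case True
      have inj: "inj_on ?v (set b)" if "b \<in> set Is" for b
        using True that Is(1) by (simp add: distinct_map)
      have inj': "inj_on ?w (set b)" if "b \<in> set Js" for b
        using True that Js(1) unfolding Q'_eq by (metis distinct_map imageE)
      define T where "T = matching_filling \<alpha> Is"
      define T' where "T' = matching_filling \<beta> Js"
      note F = noncrossing_filling_of_matching[OF Q[folded Is(1)] Is(2) bd(1) rows \<alpha> lens(1) Is(4) inj, folded T_def]
      note F' = noncrossing_filling_of_matching[OF Q'[folded Js(1), unfolded size] Js(2) bd(2)[unfolded size]
          rows'[unfolded size] \<beta> lens(2)[unfolded wc, unfolded size] Js(4) inj', folded T'_def]
      have lam: "row_counts.shape (size \<beta>) (word_count (size \<beta>) \<rho>') = ?lam"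
        by (simp only: wc size[symmetric])
      have "noncrossing_bitableau n ?lam (T, T')"
        using F(1,3,4) F'(1,3,4) row_counts.is_partition_shape[OF rows]
        unfolding lam by (simp add: noncrossing_bitableau_def bitableau_def)
      moreover have "bitableau_content (T, T') = (\<alpha>, \<beta>)"
        using F(2) F'(2) by (simp add: bitableau_content_def)
      moreover have "bitableau_monomial (T, T') = (\<Prod>b\<in>Q. ?minor b)"
      proof -
        have "zip T T' = map (\<lambda>b. (map ?v b, map ?w (map \<sigma>\<^sub>0 b))) Is"
          unfolding T_def T'_def matching_filling_def map[symmetric] by (simp add: zip_map_map zip_same_conv_map)
        then have "bitableau_monomial (T, T') = (\<Prod>b\<leftarrow>Is. minor (set (map ?v b)) (set (map ?w (map \<sigma>\<^sub>0 b))))"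
          by (simp add: bitableau_monomial_def o_def)
        also have "\<dots> = (\<Prod>b\<in>Q. minor (set (map ?v b)) (set (map ?w (map \<sigma>\<^sub>0 b))))"
          unfolding Is(1)[symmetric] by (rule prod.distinct_set_conv_list[OF Is(2), symmetric])
        also have "\<dots> = (\<Prod>b\<in>Q. ?minor b)"
        proof (intro prod.cong refl)
          fix b assume b: "b \<in> Q"
          have "sorted_wrt (<) (map ?v b)" "sorted_wrt (<) (map ?w (map \<sigma>\<^sub>0 b))"
            using F(5)[of b] F'(5)[of "map \<sigma>\<^sub>0 b"] b Is(1) Js(1) Q'_eq by auto
          then show "minor (set (map ?v b)) (set (map ?w (map \<sigma>\<^sub>0 b))) = ?minor b"
            unfolding minor_eq by (intro minor_strict) simp_all
        qed
        finally show ?thesis .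
      qed
      ultimately show ?thesis
        unfolding poly by (intro matpoly.span_base) (auto intro: sym)
    qed
    with \<sigma>\<^sub>0 Q'_eq show "\<exists>\<sigma>\<^sub>0. \<sigma>\<^sub>0 permutes {1..?N} \<and> Q' = map \<sigma>\<^sub>0 ` Q \<and>
        ?P (block_alternator Q \<sigma>\<^sub>0) \<in> matpoly.span ?G"
      by blast
  qed
qed

section \<open>Expansion of bideterminants into monomials of the same content\<close>

definition content_monomials :: "nat multiset \<Rightarrow> nat multiset \<Rightarrow> matpoly set" where
  "content_monomials \<alpha> \<beta> = {\<Prod>(i, j)\<leftarrow>ps. X i j | ps.
     image_mset fst (mset ps) = \<alpha> \<and> image_mset snd (mset ps) = \<beta>}"

lemma matpoly_scale_mult_left: "matpoly_scale c p * q = matpoly_scale c (p * q)"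
  by (simp add: matpoly_scale_def mult.assoc)

lemma matpoly_span_mult:
  assumes "a \<in> matpoly.span A" "b \<in> matpoly.span B" "\<And>x y. x \<in> A \<Longrightarrow> y \<in> B \<Longrightarrow> x * y \<in> matpoly.span C"
  shows "a * b \<in> matpoly.span C"
  using assms(1)
proof (induction rule: matpoly.span_induct_alt)
  case base
  then show ?case by (simp add: matpoly.span_zero)
next
  case (step c x y)
  have "x * b \<in> matpoly.span C"
    using assms(2)
  proof (induction rule: matpoly.span_induct_alt)
    case base
    then show ?case by (simp add: matpoly.span_zero)
  next
    case (step d z w)
    have "x * (matpoly_scale d z + w) = matpoly_scale d (x * z) + x * w"
      by (simp add: distrib_left matpoly_scale_def mult.left_commute)
    then show ?case
      using step assms(3) \<open>x \<in> A\<close> by (simp add: matpoly.span_add matpoly.span_scale)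
  qed
  then show ?case
    using step by (simp add: distrib_right matpoly_scale_mult_left matpoly.span_add matpoly.span_scale)
qed

lemma minor_in_span_content_monomials:
  assumes "finite I" "finite J" "card I = card J"
  shows "minor I J \<in> matpoly.span (content_monomials (mset_set I) (mset_set J))"
proof -
  let ?I = "sorted_list_of_set I" and ?J = "sorted_list_of_set J" and ?k = "card I"
  have "of_int (sign p) * (\<Prod>i\<in>{0..<?k}. X (?I ! i) (?J ! p i))
      \<in> matpoly.span (content_monomials (mset_set I) (mset_set J))" if p: "p permutes {0..<?k}" for p
  proof -
    let ?ps = "map (\<lambda>i. (?I ! i, ?J ! p i)) [0..<?k]"
    have nth: "image_mset ((!) xs) (mset_set {0..<length xs}) = mset xs" for xs :: "nat list"
      by (metis map_nth mset_map mset_upt)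
    have "image_mset fst (mset ?ps) = image_mset ((!) ?I) (mset_set {0..<?k})"
      by (simp add: multiset.map_comp o_def)
    also have "\<dots> = mset_set I"
      using nth[of ?I] assms by (metis distinct_sorted_list_of_set length_sorted_list_of_set mset_set_set set_sorted_list_of_set)
    finally have fst: "image_mset fst (mset ?ps) = mset_set I" .
    have "image_mset snd (mset ?ps) = image_mset ((!) ?J) (image_mset p (mset_set {0..<?k}))"
      by (simp add: multiset.map_comp o_def)
    also have "image_mset p (mset_set {0..<?k}) = mset_set {0..<?k}"
      by (rule permutes_image_mset[OF p])
    also have "image_mset ((!) ?J) (mset_set {0..<?k}) = mset_set J"
      using nth[of ?J] assms by (metis distinct_sorted_list_of_set length_sorted_list_of_set mset_set_set set_sorted_list_of_set)
    finally have snd: "image_mset snd (mset ?ps) = mset_set J" .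
    have "(\<Prod>i\<in>{0..<?k}. X (?I ! i) (?J ! p i)) = (\<Prod>(i, j)\<leftarrow>?ps. X i j)"
      by (simp add: o_def prod.distinct_set_conv_list[symmetric])
    also have "\<dots> \<in> content_monomials (mset_set I) (mset_set J)"
      unfolding content_monomials_def using fst snd by blast
    finally show ?thesis
      unfolding matpoly_scale_of_int[symmetric] by (intro matpoly.span_scale matpoly.span_base)
  qed
  moreover have "minor I J = (\<Sum>p | p permutes {0..<?k}.
      of_int (sign p) * (\<Prod>i\<in>{0..<?k}. X (?I ! i) (?J ! p i)))"
  proof -
    have "p i < ?k" if "p permutes {0..<?k}" "i < ?k" for p i
      using permutes_in_image[OF that(1), of i] that(2) by simp
    then show ?thesis
      using assms(3) by (simp add: minor_def det_def)
  qed
  ultimately show ?thesis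
    by (auto intro: matpoly.span_sum)
qed

lemma content_monomials_mult:
  assumes "x \<in> content_monomials \<alpha> \<beta>" "y \<in> content_monomials \<alpha>' \<beta>'"
  shows "x * y \<in> content_monomials (\<alpha> + \<alpha>') (\<beta> + \<beta>')"
proof -
  obtain ps qs where "x = (\<Prod>(i, j)\<leftarrow>ps. X i j)" "y = (\<Prod>(i, j)\<leftarrow>qs. X i j)"
    "image_mset fst (mset ps) = \<alpha>" "image_mset snd (mset ps) = \<beta>"
    "image_mset fst (mset qs) = \<alpha>'" "image_mset snd (mset qs) = \<beta>'"
    using assms by (auto simp: content_monomials_def)
  then show ?thesis
    unfolding content_monomials_def by (auto intro!: exI[of _ "ps @ qs"])
qed

lemma bideterminant_in_span_content_monomials:
  assumes "minor_indices n Ms"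
  shows "bideterminant Ms \<in> matpoly.span (content_monomials (fst (bidet_content Ms)) (snd (bidet_content Ms)))"
  using assms
proof (induction Ms)
  case Nil
  have "1 \<in> content_monomials {#} {#}"
    by (auto simp: content_monomials_def)
  then show ?case
    by (simp add: bideterminant_def bidet_content_def matpoly.span_base)
next
  case (Cons M Ms)
  obtain I J where M: "M = (I, J)"
    by fastforce
  have IJ: "finite I" "finite J" "card I = card J" and Ms: "minor_indices n Ms"
    using Cons.prems by (auto simp: minor_indices_def M intro: finite_subset)
  have "minor I J * bideterminant Ms \<in> matpoly.span (content_monomials
      (mset_set I + fst (bidet_content Ms)) (mset_set J + snd (bidet_content Ms)))"
    by (rule matpoly_span_mult[OF minor_in_span_content_monomials[OF IJ] Cons.IH[OF Ms]])
      (intro matpoly.span_base content_monomials_mult)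
  then show ?case
    by (simp add: bideterminant_def bidet_content_def M)
qed

text \<open>Sort the row indices by a permutation \<pi> and the column indices by a permutation
  \<tau>. The monomial is then the specialization of the single permutation
  \<open>\<tau> \<circ> \<pi>\<inverse>\<close>, and \<open>f\<close> is its indicator
  function.\<close>

lemma content_monomial_eq_perm_poly:
  assumes "p \<in> content_monomials \<alpha> \<beta>"
  shows "\<exists>f. p = perm_poly (size \<alpha>) (position_value \<alpha>) (position_value \<beta>) f"
proof -
  obtain ps where p: "p = (\<Prod>(i, j)\<leftarrow>ps. X i j)"
    and ps: "image_mset fst (mset ps) = \<alpha>" "image_mset snd (mset ps) = \<beta>"
    using assms by (auto simp: content_monomials_def)
  let ?N = "size \<alpha>" and ?v = "position_value \<alpha>" and ?w = "position_value \<beta>"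
  \<comment> \<open>Positions start at 1, list indices at 0.\<close>
  define r where "r x = fst (ps ! (x - 1))" for x
  define s where "s x = snd (ps ! (x - 1))" for x
  have len: "length ps = ?N" "size \<beta> = ?N"
    using ps by auto
  have shift: "image_mset h (mset_set {1..?N}) = image_mset (\<lambda>k. h (Suc k)) (mset_set {0..<?N})"
    for h :: "nat \<Rightarrow> nat"
  proof -
    have "mset_set {1..?N} = image_mset Suc (mset_set {0..<?N})"
      by (simp add: image_mset_mset_set image_Suc_atLeastLessThan atLeastLessThanSuc_atLeastAtMost)
    then show ?thesis
      by (simp add: multiset.map_comp o_def)
  qed
  have nth: "image_mset (\<lambda>k. h (ps ! k)) (mset_set {0..<?N}) = image_mset h (mset ps)" for h :: "nat \<times> nat \<Rightarrow> nat"
  proof -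
    have "mset ps = image_mset ((!) ps) (mset_set {0..<?N})"
      unfolding len(1)[symmetric] by (metis map_nth mset_map mset_upt)
    then show ?thesis
      by (simp add: multiset.map_comp o_def)
  qed
  have "image_mset r (mset_set {1..?N}) = image_mset ?v (mset_set {1..?N})"
    unfolding image_mset_position_value unfolding shift using nth[of fst] ps by (simp add: r_def)
  then obtain \<pi> where \<pi>: "\<pi> permutes {1..?N}" "\<forall>x\<in>{1..?N}. r x = ?v (\<pi> x)"
    using image_mset_eq_implies_permutes[of "{1..?N}" r ?v] by auto
  have "image_mset s (mset_set {1..?N}) = image_mset ?w (mset_set {1..?N})"
    using image_mset_position_value[of \<beta>] len(2) shift[of s] nth[of snd] ps by (simp add: s_def)
  then obtain \<tau> where \<tau>: "\<tau> permutes {1..?N}" "\<forall>x\<in>{1..?N}. s x = ?w (\<tau> x)"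
    using image_mset_eq_implies_permutes[of "{1..?N}" s ?w] by auto
  define \<sigma> where "\<sigma> = \<tau> \<circ> inv_into UNIV \<pi>"
  have \<sigma>: "\<sigma> permutes {1..?N}"
    unfolding \<sigma>_def by (intro permutes_compose permutes_inv \<pi>(1) \<tau>(1))
  have "p = (\<Prod>k\<in>{0..<?N}. X (r (Suc k)) (s (Suc k)))"
    unfolding p prod.list_conv_set_nth
    by (intro prod.cong) (auto simp: len r_def s_def case_prod_beta)
  also have "\<dots> = (\<Prod>x\<in>{1..?N}. X (r x) (s x))"
    by (simp add: prod.atLeast1_atMost_eq atLeast0LessThan)
  also have "\<dots> = (\<Prod>x\<in>{1..?N}. X (?v (\<pi> x)) (?w (\<sigma> (\<pi> x))))"
    using \<pi>(2) \<tau>(2) by (intro prod.cong) (auto simp: \<sigma>_def permutes_inverses(2)[OF \<pi>(1)])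
  also have "\<dots> = word_monomial ?N ?v (?w \<circ> \<sigma>)"
    using prod.permute[OF \<pi>(1), of "\<lambda>x. X (?v x) (?w (\<sigma> x))"] by (simp add: word_monomial_def o_def)
  also have "\<dots> = perm_poly ?N ?v ?w (\<lambda>\<tau>. if \<tau> = \<sigma> then 1 else 0)"
  proof -
    have "perm_poly ?N ?v ?w (\<lambda>\<tau>. if \<tau> = \<sigma> then 1 else 0) =
      (\<Sum>\<tau> | \<tau> permutes {1..?N}. if \<tau> = \<sigma> then word_monomial ?N ?v (?w \<circ> \<tau>) else 0)"
      unfolding perm_poly_def by (intro sum.cong) auto
    then show ?thesis
      using \<sigma> by (simp add: finite_permutations)
  qed
  finally show ?thesis by blast
qed

section \<open>Bitableau monomials as bideterminants, and the two inclusions\<close>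

lemma bitableau_monomial_eq_bideterminant:
  assumes "bitableau n lam (T, T')"
  obtains Ms where "minor_indices n Ms" "bideterminant Ms = bitableau_monomial (T, T')"
    "bidet_content Ms = bitableau_content (T, T')"
proof
  let ?Ms = "map (\<lambda>(c, c'). (set c, set c')) (zip T T')"
  have strict: "sorted_wrt (<) c" "set c \<subseteq> {1..n}" if "c \<in> set T \<or> c \<in> set T'" for c
    using that assms by (auto simp: bitableau_def column_strict_filling_def)
  have lens: "map length T = map length T'"
    using assms by (simp add: bitableau_def column_strict_filling_def)
  then have len: "length T = length T'"
    by (metis length_map)
  have "length c = length c'" if "(c, c') \<in> set (zip T T')" for c c'
    using that lens len by (auto simp: set_zip) (metis nth_map)
  then have "set c \<subseteq> {1..n} \<and> set c' \<subseteq> {1..n} \<and> card (set c) = card (set c')" if "(c, c') \<in> set (zip T T')" for c c'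
    using strict[of c] strict[of c'] set_zip_leftD[OF that] set_zip_rightD[OF that] that
    by (simp add: card_set_strict)
  then show "minor_indices n ?Ms"
    unfolding minor_indices_def by auto
  show "bideterminant ?Ms = bitableau_monomial (T, T')"
    by (simp add: bideterminant_def bitableau_monomial_def case_prod_unfold o_def)
  have content: "(\<Sum>c\<leftarrow>T. mset_set (set c)) = filling_content T" "(\<Sum>c\<leftarrow>T'. mset_set (set c)) = filling_content T'"
    unfolding filling_content_def using strict
    by (auto intro!: arg_cong[where f = sum_list] simp: mset_set_set strict_sorted_iff)
  have "map (\<lambda>z. mset_set (set (fst z))) (zip T T') = map (\<lambda>c. mset_set (set c)) T"
    "map (\<lambda>z. mset_set (set (snd z))) (zip T T') = map (\<lambda>c. mset_set (set c)) T'"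
    using len by (auto simp: list_eq_iff_nth_eq)
  then show "bidet_content ?Ms = bitableau_content (T, T')"
    by (simp add: bidet_content_def bitableau_content_def case_prod_unfold o_def flip: content)
qed

theorem theorem18:
  fixes n :: nat and \<alpha> \<beta> :: "nat multiset"
  assumes "set_mset \<alpha> \<subseteq> {1..n}" and "set_mset \<beta> \<subseteq> {1..n}" and "size \<alpha> = size \<beta>"
  shows "matpoly.span {bitableau_monomial TT | lam TT.
           noncrossing_bitableau n lam TT \<and> bitableau_content TT = (\<alpha>, \<beta>)} = V n \<alpha> \<beta>"
    (is "matpoly.span ?G = _")
proof
  have "?G \<subseteq> {bideterminant Ms | Ms. minor_indices n Ms \<and> bidet_content Ms = (\<alpha>, \<beta>)}"
  proof
    fix p assume "p \<in> ?G"
    then obtain lam T T' where p: "p = bitableau_monomial (T, T')" "bitableau_content (T, T') = (\<alpha>, \<beta>)"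
        "bitableau n lam (T, T')"
      by (auto simp: noncrossing_bitableau_def)
    obtain Ms where "minor_indices n Ms" "bideterminant Ms = p" "bidet_content Ms = (\<alpha>, \<beta>)"
      using bitableau_monomial_eq_bideterminant[OF p(3)] p(1,2) by metis
    then show "p \<in> {bideterminant Ms | Ms. minor_indices n Ms \<and> bidet_content Ms = (\<alpha>, \<beta>)}"
      by blast
  qed
  then show "matpoly.span ?G \<subseteq> V n \<alpha> \<beta>"
    unfolding V_def by (rule matpoly.span_mono)
  \<comment> \<open>Monomials of content \<open>(\<alpha>, \<beta>)\<close> are treated instead of
    bideterminants: they span a space containing all bideterminants of this content, and each is a
    \<open>perm_poly\<close>.\<close>
  have "content_monomials \<alpha> \<beta> \<subseteq> matpoly.span ?G"
    using content_monomial_eq_perm_poly perm_poly_in_noncrossing_span[OF assms] by blast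
  then have "matpoly.span (content_monomials \<alpha> \<beta>) \<subseteq> matpoly.span ?G"
    by (rule matpoly.span_minimal) simp
  then have "{bideterminant Ms | Ms. minor_indices n Ms \<and> bidet_content Ms = (\<alpha>, \<beta>)} \<subseteq> matpoly.span ?G"
    using bideterminant_in_span_content_monomials by fastforce
  then show "V n \<alpha> \<beta> \<subseteq> matpoly.span ?G"
    unfolding V_def by (rule matpoly.span_minimal) simp
qed

end
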